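(* Let $\varphi:\Sigma\to M$ be an isometric immersion from a Riemannian surface $\Sigma$ into an oriented 3-dimensional Riemannian manifold $M$. Assume that $\varphi$ has positive extrinsic curvature $K$, and let $N$ be the unit normal vector field for which the second fundamental form is positive definite. Then $$\partial_z=\frac{i}{\sqrt{K}}\; N\times_\varphi \nabla_{\partial_z} N,$$ where $z$ is a local conformal parameter for the second fundamental form. Moreover, the integrability equation $0=[\partial_z,\partial_{\overline z}]$ is equivalent to $$N\times_{\varphi}\left(\nabla_{\partial_z}\left(\frac{1}{\sqrt{K}}\nabla_{\partial_{\overline z}} N\right)+\nabla_{\partial_{\overline z}}\left(\frac{1}{\sqrt{K}}\nabla_{\partial_{z}} N\right)\right)=0.$$
   Context: The extrinsic curvature $K$ is the determinant of the shape operator of $\varphi$. When $K>0$, $\Sigma$ is orientable and one of the two global unit normal fields, $N$, makes the second fundamental form $II=\langle -dN,d\varphi\rangle$ a (positive definite) Riemannian metric. A local conformal parameter $z=x+iy$ for $II$ is a complex coordinate in which $II=2\rho|dz|^2$ with $\rho>0$; it is taken positively oriented with respect to $N$, i.e. $N$ is a positive multiple of $\varphi_x\times_\varphi\varphi_y$. $\nabla$ is the Levi-Civita connection of $M$ (extended complex-linearly), $\times_\varphi$ is the (complex-bilinearly extended) cross product of $T_{\varphi}M$, and $\partial_z=\frac12(\partial_x-i\partial_y)$ is identified with its image $\varphi_z$ in $TM\otimes\mathbb{C}$. The integrability equation $[\partial_z,\partial_{\overline z}]=0$ means $\nabla_{\partial_z}\partial_{\overline z}-\nabla_{\partial_{\overline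 z}}\partial_z=0$, where $\partial_z$ and $\partial_{\overline z}$ are expressed by the displayed formula for $\partial_z$ and its complex conjugate. *)

theory Defs
  imports "HOL-Analysis.Analysis"
begin

section \<open>Smooth manifolds\<close>

text \<open>Only meaningful for open sets.\<close>

primrec ck_on :: "nat \<Rightarrow> 'a::real_normed_vector set \<Rightarrow> ('a \<Rightarrow> 'b::real_normed_vector) \<Rightarrow> bool" where
  "ck_on 0 S f \<longleftrightarrow> continuous_on S f"
| "ck_on (Suc k) S f \<longleftrightarrow> (\<forall>x\<in>S. f differentiable (at x)) \<and>
     (\<forall>v. ck_on k S (\<lambda>x. frechet_derivative f (at x) v))"

definition smooth_on :: "'a::real_normed_vector set \<Rightarrow> ('a \<Rightarrow> 'b::real_normed_vector) \<Rightarrow> bool" where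
  "smooth_on S f \<longleftrightarrow> (\<forall>k. ck_on k S f)"

text \<open>A chart is a pair of its domain and its coordinate map; the values of the coordinate map
  outside the domain are irrelevant.\<close>

type_synonym ('p, 'n) chart = "'p set \<times> ('p \<Rightarrow> real^'n)"

definition chart_inv :: "('p, 'n) chart \<Rightarrow> real^'n \<Rightarrow> 'p" where
  "chart_inv c = inv_into (fst c) (snd c)"

definition is_chart :: "'p topology \<Rightarrow> ('p, 'n::finite) chart \<Rightarrow> bool" where
  "is_chart X c \<longleftrightarrow> openin X (fst c) \<and> open (snd c ` fst c) \<and>
     homeomorphic_map (subtopology X (fst c)) (top_of_set (snd c ` fst c)) (snd c)"

definition transition :: "('p, 'n) chart \<Rightarrow> ('p, 'n) chart \<Rightarrow> real^'n \<Rightarrow> real^'n" where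
  "transition c c' = snd c' \<circ> chart_inv c"

definition transition_deriv ::
    "('p, 'n::finite) chart \<Rightarrow> ('p, 'n) chart \<Rightarrow> 'p \<Rightarrow> real^'n \<Rightarrow> real^'n" where
  "transition_deriv c c' p = frechet_derivative (transition c c') (at (snd c p))"

definition smooth_atlas :: "'p topology \<Rightarrow> ('p, 'n::finite) chart set \<Rightarrow> bool" where
  "smooth_atlas X A \<longleftrightarrow> (\<forall>c\<in>A. is_chart X c) \<and> (\<Union>c\<in>A. fst c) = topspace X \<and>
     (\<forall>c\<in>A. \<forall>c'\<in>A. smooth_on (snd c ` (fst c \<inter> fst c')) (transition c c'))"

text \<open>The atlas is maximal, so that its elements are all the local coordinate systems of the
  smooth structure.\<close>

definition smooth_manifold :: "'p topology \<Rightarrow> ('p, 'n::finite) chart set \<Rightarrow> bool" where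
  "smooth_manifold X A \<longleftrightarrow> Hausdorff_space X \<and> second_countable X \<and> smooth_atlas X A \<and>
     (\<forall>B. smooth_atlas X B \<and> A \<subseteq> B \<longrightarrow> B = A)"

text \<open>An orientation is given by an oriented atlas \<open>Or\<close>, whose charts are the positive ones.\<close>

definition orientation ::
    "'p topology \<Rightarrow> ('p, 'n::finite) chart set \<Rightarrow> ('p, 'n) chart set \<Rightarrow> bool" where
  "orientation X A Or \<longleftrightarrow> Or \<subseteq> A \<and> (\<Union>c\<in>Or. fst c) = topspace X \<and>
     (\<forall>c\<in>Or. \<forall>c'\<in>Or. \<forall>p\<in>fst c \<inter> fst c'. det (matrix (transition_deriv c c' p)) > 0)"


section \<open>Riemannian metrics\<close>

text \<open>Tensor fields are given by their components in every chart, subject to the transformation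
  law under change of chart. Thus \<open>g c p u v\<close> is the inner product of the two tangent vectors at
  \<open>p\<close> whose components in the chart \<open>c\<close> are \<open>u\<close> and \<open>v\<close>.\<close>

type_synonym ('p, 'n) metric =
  "('p, 'n) chart \<Rightarrow> 'p \<Rightarrow> real^'n \<Rightarrow> real^'n \<Rightarrow> real"

definition riemannian_metric :: "('p, 'n::finite) chart set \<Rightarrow> ('p, 'n) metric \<Rightarrow> bool" where
  "riemannian_metric A g \<longleftrightarrow>
     (\<forall>c\<in>A. \<forall>p\<in>fst c. bilinear (g c p) \<and> (\<forall>u v. g c p u v = g c p v u) \<and>
        (\<forall>u. u \<noteq> 0 \<longrightarrow> g c p u u > 0)) \<and>
     (\<forall>c\<in>A. \<forall>u v. smooth_on (snd c ` fst c) (\<lambda>x. g c (chart_inv c x) u v)) \<and>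
     (\<forall>c\<in>A. \<forall>c'\<in>A. \<forall>p\<in>fst c \<inter> fst c'. \<forall>u v.
        g c' p (transition_deriv c c' p u) (transition_deriv c c' p v) = g c p u v)"

definition riemannian_manifold ::
    "'p topology \<Rightarrow> ('p, 'n::finite) chart set \<Rightarrow> ('p, 'n) metric \<Rightarrow> bool" where
  "riemannian_manifold X A g \<longleftrightarrow> smooth_manifold X A \<and> riemannian_metric A g"

text \<open>In a chart \<open>d\<close> the Levi-Civita connection is \<open>\<nabla>\<^sub>u V = D\<^sub>u V + \<Gamma>(u, V)\<close>; the bilinear map
  \<open>\<Gamma>\<close> at \<open>q\<close> (the Christoffel symbols) is characterised by vanishing torsion (symmetry) and
  compatibility with the metric, the latter being tested on fields with constant components.\<close>

definition christoffel ::
    "('p, 'n::finite) metric \<Rightarrow> ('p, 'n) chart \<Rightarrow> 'p \<Rightarrow> real^'n \<Rightarrow> real^'n \<Rightarrow> real^'n" where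
  "christoffel g d q = (THE G. bilinear G \<and> (\<forall>u v. G u v = G v u) \<and>
     (\<forall>w u v. frechet_derivative (\<lambda>x. g d (chart_inv d x) u v) (at (snd d q)) w =
        g d q (G w u) v + g d q u (G w v)))"

text \<open>The cross product is determined by \<open>\<langle>u \<times> v, y\<rangle> = vol(u, v, y)\<close>, where \<open>vol\<close> is the Riemannian
  volume form. The formula used for \<open>vol\<close> is the one in positively oriented charts \<open>d\<close>.\<close>

definition gram :: "('p, 'n::finite) metric \<Rightarrow> ('p, 'n) chart \<Rightarrow> 'p \<Rightarrow> real^'n^'n" where
  "gram g d q = (\<chi> i j. g d q (axis i 1) (axis j 1))"

definition cross_prod ::
    "('m, 3) metric \<Rightarrow> ('m, 3) chart \<Rightarrow> 'm \<Rightarrow> real^3 \<Rightarrow> real^3 \<Rightarrow> real^3" where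
  "cross_prod g d q u v =
     (THE w. \<forall>y. g d q w y = sqrt (det (gram g d q)) * det (vector [u, v, y] :: real^3^3))"


section \<open>Maps and vector fields along maps\<close>

definition local_rep ::
    "('s \<Rightarrow> 'm) \<Rightarrow> ('s, 'k) chart \<Rightarrow> ('m, 'n) chart \<Rightarrow> real^'k \<Rightarrow> real^'n" where
  "local_rep \<phi> c d = snd d \<circ> \<phi> \<circ> chart_inv c"

definition dmap ::
    "('s \<Rightarrow> 'm) \<Rightarrow> ('s, 'k::finite) chart \<Rightarrow> ('m, 'n::finite) chart \<Rightarrow> 's \<Rightarrow> real^'k \<Rightarrow> real^'n" where
  "dmap \<phi> c d p = frechet_derivative (local_rep \<phi> c d) (at (snd c p))"

definition overlap :: "('s \<Rightarrow> 'm) \<Rightarrow> ('s, 'k) chart \<Rightarrow> ('m, 'n) chart \<Rightarrow> 's set" where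
  "overlap \<phi> c d = {p \<in> fst c. \<phi> p \<in> fst d}"

definition smooth_map ::
    "'s topology \<Rightarrow> ('s, 'k::finite) chart set \<Rightarrow> 'm topology \<Rightarrow> ('m, 'n::finite) chart set \<Rightarrow>
     ('s \<Rightarrow> 'm) \<Rightarrow> bool" where
  "smooth_map X A Y B \<phi> \<longleftrightarrow> continuous_map X Y \<phi> \<and>
     (\<forall>c\<in>A. \<forall>d\<in>B. smooth_on (snd c ` overlap \<phi> c d) (local_rep \<phi> c d))"

definition immersion ::
    "'s topology \<Rightarrow> ('s, 'k::finite) chart set \<Rightarrow> 'm topology \<Rightarrow> ('m, 'n::finite) chart set \<Rightarrow>
     ('s \<Rightarrow> 'm) \<Rightarrow> bool" where
  "immersion X A Y B \<phi> \<longleftrightarrow> smooth_map X A Y B \<phi> \<and>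
     (\<forall>c\<in>A. \<forall>d\<in>B. \<forall>p\<in>overlap \<phi> c d. inj (dmap \<phi> c d p))"

definition isometric_immersion ::
    "'s topology \<Rightarrow> ('s, 'k::finite) chart set \<Rightarrow> ('s, 'k) metric \<Rightarrow>
     'm topology \<Rightarrow> ('m, 'n::finite) chart set \<Rightarrow> ('m, 'n) metric \<Rightarrow> ('s \<Rightarrow> 'm) \<Rightarrow> bool" where
  "isometric_immersion X A h Y B g \<phi> \<longleftrightarrow> immersion X A Y B \<phi> \<and>
     (\<forall>c\<in>A. \<forall>d\<in>B. \<forall>p\<in>overlap \<phi> c d. \<forall>u v.
        h c p u v = g d (\<phi> p) (dmap \<phi> c d p u) (dmap \<phi> c d p v))"

text \<open>A vector field along \<open>\<phi>\<close> is again given by components: \<open>V d p\<close> are the components of the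
  vector at \<open>\<phi> p\<close> in the chart \<open>d\<close>.\<close>

definition smooth_field_along ::
    "('s, 'k::finite) chart set \<Rightarrow> ('m, 'n::finite) chart set \<Rightarrow> ('s \<Rightarrow> 'm) \<Rightarrow>
     (('m, 'n) chart \<Rightarrow> 's \<Rightarrow> real^'n) \<Rightarrow> bool" where
  "smooth_field_along A B \<phi> V \<longleftrightarrow>
     (\<forall>c\<in>A. \<forall>d\<in>B. smooth_on (snd c ` overlap \<phi> c d) (V d \<circ> chart_inv c)) \<and>
     (\<forall>c\<in>A. \<forall>p\<in>fst c. \<forall>d\<in>B. \<forall>d'\<in>B. \<phi> p \<in> fst d \<inter> fst d' \<longrightarrow>
        V d' p = transition_deriv d d' (\<phi> p) (V d p))"

definition unit_normal ::
    "('s, 'k::finite) chart set \<Rightarrow> ('m, 'n::finite) chart set \<Rightarrow> ('m, 'n) metric \<Rightarrow> ('s \<Rightarrow> 'm) \<Rightarrow>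
     (('m, 'n) chart \<Rightarrow> 's \<Rightarrow> real^'n) \<Rightarrow> bool" where
  "unit_normal A B g \<phi> N \<longleftrightarrow> smooth_field_along A B \<phi> N \<and>
     (\<forall>c\<in>A. \<forall>d\<in>B. \<forall>p\<in>overlap \<phi> c d.
        g d (\<phi> p) (N d p) (N d p) = 1 \<and> (\<forall>u. g d (\<phi> p) (N d p) (dmap \<phi> c d p u) = 0))"

text \<open>The covariant derivative along \<open>\<phi>\<close>, for a field given by its components \<open>V\<close> in the chart
  \<open>d\<close>, at \<open>p\<close> in the direction with components \<open>u\<close> in the chart \<open>c\<close>.\<close>

definition cov_deriv ::
    "('m, 'n::finite) metric \<Rightarrow> ('s \<Rightarrow> 'm) \<Rightarrow> ('s, 'k::finite) chart \<Rightarrow> ('m, 'n) chart \<Rightarrow>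
     real^'k \<Rightarrow> ('s \<Rightarrow> real^'n) \<Rightarrow> 's \<Rightarrow> real^'n" where
  "cov_deriv g \<phi> c d u V p =
     frechet_derivative (V \<circ> chart_inv c) (at (snd c p)) u
     + christoffel g d (\<phi> p) (dmap \<phi> c d p u) (V p)"


section \<open>Extrinsic geometry\<close>

text \<open>The shape operator \<open>S\<close> is determined by \<open>d\<phi>(S u) = -\<nabla>\<^sub>u N\<close>.\<close>

definition shape_operator ::
    "('m, 'n::finite) metric \<Rightarrow> ('s \<Rightarrow> 'm) \<Rightarrow> (('m, 'n) chart \<Rightarrow> 's \<Rightarrow> real^'n) \<Rightarrow>
     ('s, 'k::finite) chart \<Rightarrow> ('m, 'n) chart \<Rightarrow> 's \<Rightarrow> real^'k \<Rightarrow> real^'k" where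
  "shape_operator g \<phi> N c d p u =
     (THE w. dmap \<phi> c d p w = - cov_deriv g \<phi> c d u (N d) p)"

text \<open>The value does not depend on the charts \<open>c\<close> and \<open>d\<close>, which only serve to compute it.\<close>

definition extrinsic_curvature ::
    "('m, 'n::finite) metric \<Rightarrow> ('s \<Rightarrow> 'm) \<Rightarrow> (('m, 'n) chart \<Rightarrow> 's \<Rightarrow> real^'n) \<Rightarrow>
     ('s, 'k::finite) chart \<Rightarrow> ('m, 'n) chart \<Rightarrow> 's \<Rightarrow> real" where
  "extrinsic_curvature g \<phi> N c d p = det (matrix (shape_operator g \<phi> N c d p))"

definition second_form ::
    "('m, 'n::finite) metric \<Rightarrow> ('s \<Rightarrow> 'm) \<Rightarrow> (('m, 'n) chart \<Rightarrow> 's \<Rightarrow> real^'n) \<Rightarrow>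
     ('s, 'k::finite) chart \<Rightarrow> ('m, 'n) chart \<Rightarrow> 's \<Rightarrow> real^'k \<Rightarrow> real^'k \<Rightarrow> real" where
  "second_form g \<phi> N c d p u v =
     g d (\<phi> p) (- cov_deriv g \<phi> c d u (N d) p) (dmap \<phi> c d p v)"

text \<open>A local parameter \<open>z = x + iy\<close> is a chart with coordinates \<open>(x, y)\<close>.\<close>

definition dir_x :: "real^2" where "dir_x = axis 1 1"
definition dir_y :: "real^2" where "dir_y = axis 2 1"

text \<open>\<open>II = 2\<rho>|dz|\<^sup>2 = 2\<rho>(dx\<^sup>2 + dy\<^sup>2)\<close> with \<open>\<rho> > 0\<close>, and \<open>N\<close> is a positive multiple of
  \<open>\<phi>\<^sub>x \<times> \<phi>\<^sub>y\<close>.\<close>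

definition conformal_parameter ::
    "('s, 2) chart set \<Rightarrow> ('m, 3) chart set \<Rightarrow> ('m, 3) metric \<Rightarrow> ('s \<Rightarrow> 'm) \<Rightarrow>
     (('m, 3) chart \<Rightarrow> 's \<Rightarrow> real^3) \<Rightarrow> ('s, 2) chart \<Rightarrow> bool" where
  "conformal_parameter A Or g \<phi> N z \<longleftrightarrow> z \<in> A \<and>
     (\<exists>\<rho>. \<forall>p\<in>fst z. \<rho> p > 0 \<and>
        (\<forall>d\<in>Or. \<phi> p \<in> fst d \<longrightarrow> (\<forall>u v. second_form g \<phi> N z d p u v = 2 * \<rho> p * (u \<bullet> v)))) \<and>
     (\<forall>d\<in>Or. \<forall>p\<in>overlap \<phi> z d. \<exists>k>0.
        N d p = k *\<^sub>R cross_prod g d (\<phi> p) (dmap \<phi> z d p dir_x) (dmap \<phi> z d p dir_y))"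


section \<open>Complexification\<close>

text \<open>The component vectors of elements of \<open>TM \<otimes> \<complex>\<close> are in \<open>complex^'n\<close>. Cross product and
  covariant derivative are extended complex-linearly in each argument, with
  \<open>\<partial>\<^sub>z = (\<partial>\<^sub>x - i\<partial>\<^sub>y)/2\<close>.\<close>

definition vRe :: "complex^'n \<Rightarrow> real^'n" where "vRe v = (\<chi> i. Re (v $ i))"
definition vIm :: "complex^'n \<Rightarrow> real^'n" where "vIm v = (\<chi> i. Im (v $ i))"
definition vcomplex :: "real^'n \<Rightarrow> real^'n \<Rightarrow> complex^'n" where
  "vcomplex a b = (\<chi> i. Complex (a $ i) (b $ i))"
definition vof_real :: "real^'n \<Rightarrow> complex^'n" where "vof_real a = vcomplex a 0"
definition vcnj :: "complex^'n \<Rightarrow> complex^'n" where "vcnj v = (\<chi> i. cnj (v $ i))"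

definition ccross ::
    "('m, 3) metric \<Rightarrow> ('m, 3) chart \<Rightarrow> 'm \<Rightarrow> complex^3 \<Rightarrow> complex^3 \<Rightarrow> complex^3" where
  "ccross g d q u v = vcomplex
     (cross_prod g d q (vRe u) (vRe v) - cross_prod g d q (vIm u) (vIm v))
     (cross_prod g d q (vRe u) (vIm v) + cross_prod g d q (vIm u) (vRe v))"

definition ccov_deriv ::
    "('m, 'n::finite) metric \<Rightarrow> ('s \<Rightarrow> 'm) \<Rightarrow> ('s, 'k::finite) chart \<Rightarrow> ('m, 'n) chart \<Rightarrow>
     real^'k \<Rightarrow> ('s \<Rightarrow> complex^'n) \<Rightarrow> 's \<Rightarrow> complex^'n" where
  "ccov_deriv g \<phi> c d u V p = vcomplex
     (cov_deriv g \<phi> c d u (\<lambda>q. vRe (V q)) p) (cov_deriv g \<phi> c d u (\<lambda>q. vIm (V q)) p)"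

definition nabla_z ::
    "('m, 'n::finite) metric \<Rightarrow> ('s \<Rightarrow> 'm) \<Rightarrow> ('s, 2) chart \<Rightarrow> ('m, 'n) chart \<Rightarrow>
     ('s \<Rightarrow> complex^'n) \<Rightarrow> 's \<Rightarrow> complex^'n" where
  "nabla_z g \<phi> z d V p =
     (1/2) *s (ccov_deriv g \<phi> z d dir_x V p - \<i> *s ccov_deriv g \<phi> z d dir_y V p)"

definition nabla_zbar ::
    "('m, 'n::finite) metric \<Rightarrow> ('s \<Rightarrow> 'm) \<Rightarrow> ('s, 2) chart \<Rightarrow> ('m, 'n) chart \<Rightarrow>
     ('s \<Rightarrow> complex^'n) \<Rightarrow> 's \<Rightarrow> complex^'n" where
  "nabla_zbar g \<phi> z d V p =
     (1/2) *s (ccov_deriv g \<phi> z d dir_x V p + \<i> *s ccov_deriv g \<phi> z d dir_y V p)"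

definition phi_z ::
    "('s \<Rightarrow> 'm) \<Rightarrow> ('s, 2) chart \<Rightarrow> ('m, 'n::finite) chart \<Rightarrow> 's \<Rightarrow> complex^'n" where
  "phi_z \<phi> z d p =
     (1/2) *s (vof_real (dmap \<phi> z d p dir_x) - \<i> *s vof_real (dmap \<phi> z d p dir_y))"

text \<open>The field \<open>(i/\<surd>K) N \<times> \<nabla>\<^sub>z N\<close>, which is substituted for \<open>\<partial>\<^sub>z\<close> in the integrability
  equation.\<close>

definition del_z_expr ::
    "('m, 3) metric \<Rightarrow> ('s \<Rightarrow> 'm) \<Rightarrow> (('m, 3) chart \<Rightarrow> 's \<Rightarrow> real^3) \<Rightarrow>
     ('s, 2) chart \<Rightarrow> ('m, 3) chart \<Rightarrow> 's \<Rightarrow> complex^3" where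
  "del_z_expr g \<phi> N z d p =
     (\<i> / of_real (sqrt (extrinsic_curvature g \<phi> N z d p))) *s
       ccross g d (\<phi> p) (vof_real (N d p)) (nabla_z g \<phi> z d (\<lambda>q. vof_real (N d q)) p)"

end

(*
  In a conformal parameter for II the equation II = 2 rho (dx^2 + dy^2) gives the components of
  nabla_x N and nabla_y N in the frame phi_x, phi_y, and K = 4 rho^2 / (E G - F^2), where E, F, G
  are the coefficients of the first fundamental form. Since N is a positive multiple of
  phi_x \<times> phi_y, the volume of (phi_x, phi_y, N) is sqrt (E G - F^2), and the representation of
  phi_z follows by taking inner products with the frame.

  Both sides of the equivalence hold. The left one is the symmetry of nabla_x phi_y. For the right
  one, put P = nabla_x N / sqrt K and Q = nabla_y N / sqrt K. These are combinations of phi_x and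
  phi_y with coefficients built from E, F, G, so they are differentiable, and no derivative of K
  enters. The argument of N \<times> _ is (nabla_x P + nabla_y Q) / 2; differentiating the
  inner products of P and Q with phi_x and phi_y shows that it is normal.
*)

theory Submission
  imports Defs
begin

section \<open>Positive definite forms\<close>

text \<open>Models the metric at a single point acting on component vectors. It is kept apart from
  the standard inner product of the type, which serves only for coordinates.\<close>

locale pos_form =
  fixes G :: "'a::euclidean_space \<Rightarrow> 'a \<Rightarrow> real"
  assumes bil: "bilinear G" and sym: "G u v = G v u" and pos: "u \<noteq> 0 \<Longrightarrow> G u u > 0"
begin

lemmas form_simps = bilinear_ladd[OF bil] bilinear_radd[OF bil] bilinear_lmul[OF bil]
  bilinear_rmul[OF bil] bilinear_lneg[OF bil] bilinear_rneg[OF bil] bilinear_lzero[OF bil]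
  bilinear_rzero[OF bil] bilinear_lsub[OF bil] bilinear_rsub[OF bil]

lemma linear_right: "linear (G u)"
  using bil by (simp add: bilinear_def)

lemma eqI:
  assumes "\<And>y. G u y = G v y"
  shows "u = v"
proof (rule ccontr)
  assume "u \<noteq> v"
  then have "G (u - v) (u - v) > 0" by (simp add: pos)
  moreover have "G (u - v) (u - v) = 0"
    using assms[of "u - v"] by (simp add: form_simps)
  ultimately show False by simp
qed

text \<open>\<open>T w\<close> is the Euclidean vector representing the functional
  \<open>G w\<close>. Definiteness makes \<open>T\<close> injective, and finite dimension makes it
  surjective. The unique existence is what gives the \<open>THE\<close> in the cross product and in
  the Koszul construction a meaning.\<close>

lemma riesz:
  assumes f: "linear f"
  shows "\<exists>!w. \<forall>y. G w y = f y"
proof -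
  define T where "T w = (\<Sum>b\<in>Basis. G w b *\<^sub>R b)" for w
  have T_inner: "T w \<bullet> b = G w b" if "b \<in> Basis" for w b
    using that by (simp add: T_def)
  have linT: "linear T"
    unfolding T_def by (rule linearI)
      (simp_all add: form_simps scaleR_left_distrib sum.distrib scaleR_right.sum)
  have ext: "G w y = f' y" if "linear f'" "\<And>b. b \<in> Basis \<Longrightarrow> G w b = f' b" for w f' y
    using linear_eq_on_span[OF linear_right that(1), of Basis w] that(2) by simp
  have "inj T"
  proof (subst linear_injective_0[OF linT], safe)
    fix w assume "T w = 0"
    then have "G w b = 0" if "b \<in> Basis" for b
      using T_inner[OF that, of w] by simp
    then have "G w w = 0"
      using ext[of "\<lambda>_. 0" w w] by (simp add: linear_zero)
    then show "w = 0" using pos by force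
  qed
  then have "surj T" using linear_injective_imp_surjective[OF linT] by simp
  then obtain w where "T w = (\<Sum>b\<in>Basis. f b *\<^sub>R b)" by (metis surjD)
  then have "G w b = f b" if "b \<in> Basis" for b
    using T_inner[OF that, of w] that by simp
  then have "\<forall>y. G w y = f y" using ext[OF f] by blast
  then show ?thesis
    by (rule_tac ex1I[of _ w]) (auto intro: eqI)
qed

lemma cauchy_schwarz: "(G a b)\<^sup>2 \<le> G a a * G b b"
proof (cases "a = 0")
  case True
  then show ?thesis by (simp add: form_simps)
next
  case False
  \<comment> \<open>A multiple of the part of \<open>b\<close> orthogonal to \<open>a\<close>,
    scaled by \<open>G a a\<close> to avoid a division.\<close>
  define w where "w = G a a *\<^sub>R b - G a b *\<^sub>R a"
  have "G w w \<ge> 0" using pos[of w] by (cases "w = 0") (simp_all add: form_simps)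
  moreover have "G w w = G a a * (G a a * G b b - (G a b)\<^sup>2)"
    unfolding w_def by (simp add: form_simps sym[of b a] algebra_simps power2_eq_square)
  ultimately show ?thesis
    using pos[OF False] by (simp add: zero_le_mult_iff)
qed

text \<open>Koszul's formula; \<open>D w u v\<close> plays the role of \<open>\<partial>\<^sub>w g(u, v)\<close>.\<close>

lemma ex1_christoffel:
  assumes D_lin: "\<And>u v. linear (\<lambda>w. D w u v)" and D_bil: "\<And>w. bilinear (D w)"
    and D_sym: "\<And>w u v. D w u v = D w v u"
  shows "\<exists>!C. bilinear C \<and> (\<forall>u v. C u v = C v u) \<and>
    (\<forall>w u v. D w u v = G (C w u) v + G u (C w v))"
proof -
  \<comment> \<open>The right-hand side of Koszul's formula as a functional of \<open>w\<close>;
    \<open>C u v\<close> is its Riesz representative.\<close>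
  define f where "f u v w = (D u v w + D v u w - D w u v) / 2" for u v w
  have f_lin: "linear (f u v)" for u v
    unfolding f_def using D_bil[THEN bilinear_radd] D_bil[THEN bilinear_rmul]
    by (intro linearI) (simp_all add: linear_add[OF D_lin] linear_cmul[OF D_lin] field_simps)
  define C where "C u v = (THE c. \<forall>y. G c y = f u v y)" for u v
  have GC: "G (C u v) y = f u v y" for u v y
    using theI'[OF riesz[OF f_lin, of u v]] unfolding C_def by blast
  have C_sym: "C u v = C v u" for u v
    by (rule eqI) (simp add: GC f_def D_sym[of _ u v] add_ac)
  have lin_C: "linear (C u)" for u
    by (intro linearI eqI)
      (simp_all add: GC form_simps f_def linear_add[OF D_lin] linear_cmul[OF D_lin]
        bilinear_ladd[OF D_bil] bilinear_radd[OF D_bil] bilinear_lmul[OF D_bil]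
        bilinear_rmul[OF D_bil] field_simps)
  have "bilinear C"
    unfolding bilinear_def using lin_C C_sym by (metis (no_types, lifting) ext)
  moreover have "D w u v = G (C w u) v + G u (C w v)" for w u v
    by (simp add: sym[of u "C w v"] GC f_def D_sym[of w v u] D_sym[of v w u] D_sym[of u w v] field_simps)
  moreover have "C' = C"
    if C': "\<And>u v. C' u v = C' v u" "\<And>w u v. D w u v = G (C' w u) v + G u (C' w v)" for C'
  proof (intro ext eqI)
    fix u v y
    \<comment> \<open>Uniqueness: in this alternating sum of three compatibility equations, symmetry
      of \<open>C'\<close> cancels everything but the term sought.\<close>
    have "2 * G (C' u v) y = D u v y + D v u y - D y u v"
      by (simp add: C'(2) C'(1)[of v u] C'(1)[of y u] C'(1)[of y v] sym[of "C' v y" u]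
        sym[of "C' u y" v] sym)
    then show "G (C' u v) y = G (C u v) y" by (simp add: GC f_def)
  qed
  ultimately show ?thesis
    using C_sym by (intro ex1I[of _ C]) blast+
qed

end


section \<open>Second derivatives\<close>

text \<open>The mean value theorem along \<open>u\<close> turns the second difference over the
  parallelogram spanned by \<open>t *\<^sub>R u\<close> and \<open>t *\<^sub>R v\<close> into
  \<open>t\<close> times a difference of values of \<open>f' _ u\<close>. Differentiability of these
  at \<open>p\<close> then gives the main term \<open>t\<^sup>2 * A v\<close>.\<close>

lemma second_difference_bound:
  fixes f :: "'a::real_normed_vector \<Rightarrow> real"
  assumes S: "open S" "p \<in> S" and f: "\<And>x. x \<in> S \<Longrightarrow> (f has_derivative f' x) (at x)"
    and A: "((\<lambda>x. f' x u) has_derivative A) (at p)" and e: "e > 0"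
  shows "\<exists>\<delta>>0. \<forall>t. 0 < t \<and> t < \<delta> \<longrightarrow>
    \<bar>f (p + t *\<^sub>R u + t *\<^sub>R v) - f (p + t *\<^sub>R u) - f (p + t *\<^sub>R v) + f p - t\<^sup>2 * A v\<bar> \<le> e * t\<^sup>2"
proof -
  define c where "c = norm u + norm v + 1"
  have c: "c > 0" unfolding c_def using norm_ge_zero[of u] norm_ge_zero[of v] by linarith
  obtain r where r: "r > 0" "ball p r \<subseteq> S" using S openE by blast
  \<comment> \<open>The estimate is used at two points at distance at most \<open>t * c\<close> from
    \<open>p\<close>, so each of them contributes at most \<open>e / 2 * t\<close>.\<close>
  have "e / (2 * c) > 0" using e c by simp
  with A obtain d where d: "d > 0" and est:
      "\<And>y. norm (y - p) < d \<Longrightarrow> norm (f' y u - f' p u - A (y - p)) \<le> e / (2 * c) * norm (y - p)"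
    unfolding has_derivative_at_alt by blast
  have linA: "linear A" using A has_derivative_linear by blast
  \<comment> \<open>Displacements in the parallelogram have norm at most \<open>t * c\<close>, so
    this bound keeps them inside both the ball of radius \<open>r\<close> and the range of
    \<open>est\<close>.\<close>
  define \<delta> where "\<delta> = min d r / c"
  have "\<delta> > 0" unfolding \<delta>_def using d r c by simp
  moreover have "\<bar>f (p + t *\<^sub>R u + t *\<^sub>R v) - f (p + t *\<^sub>R u) - f (p + t *\<^sub>R v) + f p - t\<^sup>2 * A v\<bar>
      \<le> e * t\<^sup>2" if t: "0 < t" "t < \<delta>" for t
  proof -
    have tc: "t * c < min d r" using t c unfolding \<delta>_def by (simp add: pos_less_divide_eq)
    have small: "norm (s *\<^sub>R u + t' *\<^sub>R v) \<le> t * c" if "0 \<le> s" "s \<le> t" "0 \<le> t'" "t' \<le> t" for s t'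
    proof -
      have "norm (s *\<^sub>R u + t' *\<^sub>R v) \<le> s * norm u + t' * norm v"
        using norm_triangle_ineq[of "s *\<^sub>R u" "t' *\<^sub>R v"] that by simp
      also have "\<dots> \<le> t * norm u + t * norm v"
        using that by (intro add_mono mult_right_mono) auto
      also have "\<dots> \<le> t * c" unfolding c_def using t by (simp add: algebra_simps)
      finally show ?thesis .
    qed
    have inS: "p + s *\<^sub>R u + t' *\<^sub>R v \<in> S" if "0 \<le> s" "s \<le> t" "0 \<le> t'" "t' \<le> t" for s t'
    proof -
      have "dist p (p + s *\<^sub>R u + t' *\<^sub>R v) = norm (s *\<^sub>R u + t' *\<^sub>R v)"
        by (metis add.assoc add_diff_cancel_left' dist_commute dist_norm)
      then show ?thesis using small[OF that] tc r(2) by (auto simp: subset_iff)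
    qed
    \<comment> \<open>The term \<open>0 *\<^sub>R v\<close> brings both summands into the form
      treated by \<open>line\<close> and \<open>est'\<close>, with \<open>t' = t\<close> and
      \<open>t' = 0\<close>.\<close>
    define \<psi> where "\<psi> s = f (p + s *\<^sub>R u + t *\<^sub>R v) - f (p + s *\<^sub>R u + 0 *\<^sub>R v)" for s
    have lin: "linear (f' x)" if "x \<in> S" for x using f[OF that] has_derivative_linear by blast
    have line: "((\<lambda>s. f (p + s *\<^sub>R u + t' *\<^sub>R v)) has_derivative
        (\<lambda>h. h * f' (p + s *\<^sub>R u + t' *\<^sub>R v) u)) (at s within {0..t})"
      if s: "0 \<le> s" "s \<le> t" "0 \<le> t'" "t' \<le> t" for s t'
    proof -
      have 1: "((\<lambda>s. p + s *\<^sub>R u + t' *\<^sub>R v) has_derivative (\<lambda>h. h *\<^sub>R u)) (at s within {0..t})"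
        by (auto intro!: derivative_eq_intros)
      show ?thesis
        using has_derivative_compose[OF 1 f[OF inS[OF s]]]
        by (simp add: linear_cmul[OF lin[OF inS[OF s]]])
    qed
    have "\<exists>\<theta>\<in>{0<..<t}. \<psi> t - \<psi> 0 =
        (t - 0) * f' (p + \<theta> *\<^sub>R u + t *\<^sub>R v) u - (t - 0) * f' (p + \<theta> *\<^sub>R u + 0 *\<^sub>R v) u"
      unfolding \<psi>_def using t by (intro mvt_simple has_derivative_diff line) auto
    then obtain \<theta> where \<theta>: "0 < \<theta>" "\<theta> < t"
      and \<psi>: "\<psi> t - \<psi> 0 = t * (f' (p + \<theta> *\<^sub>R u + t *\<^sub>R v) u - f' (p + \<theta> *\<^sub>R u + 0 *\<^sub>R v) u)"
      by (auto simp: algebra_simps)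
    have est': "\<bar>f' (p + \<theta> *\<^sub>R u + t' *\<^sub>R v) u - f' p u - A (\<theta> *\<^sub>R u + t' *\<^sub>R v)\<bar> \<le> e / 2 * t"
      if t': "0 \<le> t'" "t' \<le> t" for t'
    proof -
      have "norm (\<theta> *\<^sub>R u + t' *\<^sub>R v) \<le> t * c" using small[of \<theta> t'] \<theta> t' by simp
      moreover have "norm (\<theta> *\<^sub>R u + t' *\<^sub>R v) < d" using calculation tc by simp
      ultimately have "\<bar>f' (p + \<theta> *\<^sub>R u + t' *\<^sub>R v) u - f' p u - A (\<theta> *\<^sub>R u + t' *\<^sub>R v)\<bar>
          \<le> e / (2 * c) * (t * c)"
        using est[of "p + \<theta> *\<^sub>R u + t' *\<^sub>R v"] e c
        by (smt (verit, ccfv_SIG) add.assoc add_diff_cancel_left' divide_nonneg_pos mult_left_mono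
          real_norm_def)
      then show ?thesis using c by (simp add: field_simps)
    qed
    define R where "R = f' (p + \<theta> *\<^sub>R u + t *\<^sub>R v) u - f' (p + \<theta> *\<^sub>R u + 0 *\<^sub>R v) u - t * A v"
    have R: "\<bar>R\<bar> \<le> e * t"
    proof -
      have "e / 2 * t + e / 2 * t = e * t" by simp
      then show ?thesis
        using est'[OF less_imp_le[OF t(1)] order_refl] est'[OF order_refl less_imp_le[OF t(1)]]
        unfolding R_def linear_add[OF linA] linear_cmul[OF linA] real_scaleR_def by linarith
    qed
    have "f (p + t *\<^sub>R u + t *\<^sub>R v) - f (p + t *\<^sub>R u) - f (p + t *\<^sub>R v) + f p = \<psi> t - \<psi> 0"
      by (simp add: \<psi>_def)
    also have "\<dots> = t\<^sup>2 * A v + t * R"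
      unfolding \<psi> R_def by (simp add: algebra_simps power2_eq_square)
    finally show ?thesis
      using mult_left_mono[OF R, of t] t by (simp add: abs_mult power2_eq_square mult_ac)
  qed
  ultimately show ?thesis by blast
qed

text \<open>The second difference does not change when \<open>u\<close> and \<open>v\<close> are
  swapped, so \<open>t\<^sup>2 * A v\<close> and \<open>t\<^sup>2 * B u\<close> approximate the same
  quantity.\<close>

lemma second_derivative_symmetric_real:
  fixes f :: "'a::real_normed_vector \<Rightarrow> real"
  assumes S: "open S" "p \<in> S" and f: "\<And>x. x \<in> S \<Longrightarrow> (f has_derivative f' x) (at x)"
    and A: "((\<lambda>x. f' x u) has_derivative A) (at p)"
    and B: "((\<lambda>x. f' x v) has_derivative B) (at p)"
  shows "A v = B u"
proof (rule ccontr)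
  assume "A v \<noteq> B u"
  \<comment> \<open>A third of the gap: the two errors together reach only two thirds of it.\<close>
  define e where "e = \<bar>A v - B u\<bar> / 3"
  have e: "e > 0" using \<open>A v \<noteq> B u\<close> by (simp add: e_def)
  from second_difference_bound[OF S f A e, of v] obtain \<delta>1 where "\<delta>1 > 0" and
    1: "\<And>t. 0 < t \<Longrightarrow> t < \<delta>1 \<Longrightarrow> \<bar>f (p + t *\<^sub>R u + t *\<^sub>R v) - f (p + t *\<^sub>R u) - f (p + t *\<^sub>R v) + f p
      - t\<^sup>2 * A v\<bar> \<le> e * t\<^sup>2"
    by blast
  from second_difference_bound[OF S f B e, of u] obtain \<delta>2 where "\<delta>2 > 0" and
    2: "\<And>t. 0 < t \<Longrightarrow> t < \<delta>2 \<Longrightarrow> \<bar>f (p + t *\<^sub>R v + t *\<^sub>R u) - f (p + t *\<^sub>R v) - f (p + t *\<^sub>R u) + f p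
      - t\<^sup>2 * B u\<bar> \<le> e * t\<^sup>2"
    by blast
  define t where "t = min \<delta>1 \<delta>2 / 2"
  have t: "0 < t" "t < \<delta>1" "t < \<delta>2" using \<open>\<delta>1 > 0\<close> \<open>\<delta>2 > 0\<close> by (auto simp: t_def)
  have comm: "p + t *\<^sub>R v + t *\<^sub>R u = p + t *\<^sub>R u + t *\<^sub>R v" by (simp add: add_ac)
  have "\<bar>t\<^sup>2 * A v - t\<^sup>2 * B u\<bar> \<le> 2 * (e * t\<^sup>2)"
    using 1[OF t(1,2)] 2[OF t(1,3)] unfolding comm by linarith
  also have "\<dots> = t\<^sup>2 * (2 * e)" by simp
  finally have "t\<^sup>2 * \<bar>A v - B u\<bar> \<le> t\<^sup>2 * (2 * e)"
    by (simp add: right_diff_distrib[symmetric] abs_mult del: mult.left_commute)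
  then have "\<bar>A v - B u\<bar> \<le> 2 * e" using t(1) by simp
  then show False using e by (simp add: e_def)
qed

text \<open>Reduces to the real case by pairing \<open>f\<close> with each fixed vector
  \<open>c\<close>.\<close>

lemma second_derivative_symmetric:
  fixes f :: "'a::real_normed_vector \<Rightarrow> 'b::real_inner"
  assumes S: "open S" "p \<in> S" and f: "\<And>x. x \<in> S \<Longrightarrow> (f has_derivative f' x) (at x)"
    and A: "((\<lambda>x. f' x u) has_derivative A) (at p)"
    and B: "((\<lambda>x. f' x v) has_derivative B) (at p)"
  shows "A v = B u"
proof -
  have "A v \<bullet> c = B u \<bullet> c" for c
    using S by (rule second_derivative_symmetric_real[where f = "\<lambda>x. f x \<bullet> c"
        and f' = "\<lambda>x h. f' x h \<bullet> c"])
      (auto intro!: derivative_eq_intros f A B)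
  then show ?thesis by (metis inner_diff_left inner_eq_zero_iff right_minus_eq)
qed

section \<open>Differentiating a variable bilinear form on variable arguments\<close>

lemma bilinear_expand:
  fixes H :: "'b::euclidean_space \<Rightarrow> 'b \<Rightarrow> real"
  assumes "bilinear H"
  shows "H u v = (\<Sum>(b, c)\<in>Basis \<times> Basis. (u \<bullet> b) * ((v \<bullet> c) * H b c))"
proof -
  have "H u v = H (\<Sum>b\<in>Basis. (u \<bullet> b) *\<^sub>R b) (\<Sum>c\<in>Basis. (v \<bullet> c) *\<^sub>R c)"
    by (simp add: euclidean_representation)
  also have "\<dots> = (\<Sum>(b, c)\<in>Basis \<times> Basis. H ((u \<bullet> b) *\<^sub>R b) ((v \<bullet> c) *\<^sub>R c))"
    by (rule bilinear_sum[OF assms])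
  finally show ?thesis
    by (simp add: bilinear_lmul[OF assms] bilinear_rmul[OF assms] mult.left_commute)
qed

text \<open>Product rule for three factors, the form being one of them. Expansion in a basis reduces
  it to a finite sum of products of real functions, where only the derivatives of \<open>H\<close>
  on fixed arguments enter.\<close>

lemma has_derivative_bilinear_family:
  fixes H :: "'a::real_normed_vector \<Rightarrow> 'b::euclidean_space \<Rightarrow> 'b \<Rightarrow> real"
  assumes S: "open S" "x \<in> S" and bil: "\<And>y. y \<in> S \<Longrightarrow> bilinear (H y)"
    and H: "\<And>u v. ((\<lambda>y. H y u v) has_derivative (\<lambda>w. D w u v)) (at x)"
    and D: "\<And>w. bilinear (D w)"
    and U: "(U has_derivative U') (at x)" and V: "(V has_derivative V') (at x)"
  shows "((\<lambda>y. H y (U y) (V y)) has_derivative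
    (\<lambda>w. D w (U x) (V x) + H x (U' w) (V x) + H x (U x) (V' w))) (at x)"
proof (rule has_derivative_transform_within_open[OF _ S])
  show "((\<lambda>y. \<Sum>(b, c)\<in>Basis \<times> Basis. (U y \<bullet> b) * ((V y \<bullet> c) * H y b c)) has_derivative
      (\<lambda>w. D w (U x) (V x) + H x (U' w) (V x) + H x (U x) (V' w))) (at x)"
    unfolding bilinear_expand[OF D, of _ "U x"] bilinear_expand[OF bil[OF S(2)], of "U' _"]
      bilinear_expand[OF bil[OF S(2)], of "U x"] sum.distrib[symmetric] case_prod_beta
    by (rule has_derivative_sum)
      (auto intro!: derivative_eq_intros H U V simp: algebra_simps)
qed (simp add: bilinear_expand[OF bil, symmetric])

section \<open>Volume and cross product\<close>

text \<open>With \<open>M\<close> the matrix of \<open>H\<close> in the standard basis, the Gram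
  matrix of the rows of \<open>P\<close> is \<open>P ** M ** transpose P\<close>.\<close>

lemma det_gram_vectors:
  fixes H :: "real^'n \<Rightarrow> real^'n \<Rightarrow> real" and P :: "real^'n^'n"
  assumes "bilinear H"
  shows "det (\<chi> i j. H (P $ i) (P $ j)) = det (\<chi> i j. H (axis i 1) (axis j 1)) * (det P)\<^sup>2"
proof -
  define M :: "real^'n^'n" where "M = (\<chi> i j. H (axis i 1) (axis j 1))"
  have "H u v = (\<Sum>l\<in>UNIV. (\<Sum>k\<in>UNIV. u $ k * M $ k $ l) * v $ l)" for u v
  proof -
    have "H u v = H (\<Sum>k\<in>UNIV. u $ k *\<^sub>R axis k 1) (\<Sum>l\<in>UNIV. v $ l *\<^sub>R axis l 1)"
      using basis_expansion[of u] basis_expansion[of v]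
      by (simp add: scalar_mult_eq_scaleR)
    also have "\<dots> = (\<Sum>(k, l)\<in>UNIV \<times> UNIV. H (u $ k *\<^sub>R axis k 1) (v $ l *\<^sub>R axis l 1))"
      by (rule bilinear_sum[OF assms])
    also have "\<dots> = (\<Sum>k\<in>UNIV. \<Sum>l\<in>UNIV. u $ k * M $ k $ l * v $ l)"
      by (simp add: sum.cartesian_product M_def bilinear_lmul[OF assms] bilinear_rmul[OF assms]
          mult_ac)
    also have "\<dots> = (\<Sum>l\<in>UNIV. (\<Sum>k\<in>UNIV. u $ k * M $ k $ l) * v $ l)"
      by (subst sum.swap) (simp add: sum_distrib_right)
    finally show ?thesis .
  qed
  then have "(\<chi> i j. H (P $ i) (P $ j)) = P ** M ** transpose P"
    by (simp add: vec_eq_iff matrix_matrix_mult_def transpose_def)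
  then show ?thesis
    by (simp add: det_mul det_transpose M_def power2_eq_square)
qed

text \<open>The first and second fundamental forms at a point: \<open>a\<close>, \<open>b\<close> stand for
  \<open>\<phi>\<^sub>x\<close>, \<open>\<phi>\<^sub>y\<close> and \<open>nx\<close>, \<open>ny\<close> for the derivatives of the unit normal \<open>n\<close>.\<close>

locale conformal_point = pos_form G for G :: "real^3 \<Rightarrow> real^3 \<Rightarrow> real" +
  fixes C :: "real^3 \<Rightarrow> real^3 \<Rightarrow> real^3" and a b n nx ny :: "real^3" and k \<rho> :: real
  assumes C: "G (C u v) y =
      sqrt (det (\<chi> i j. G (axis i 1) (axis j 1))) * det (vector [u, v, y] :: real^3^3)"
    and n_eq: "n = k *\<^sub>R C a b" and k: "k > 0"
    and n: "G n n = 1" "G n a = 0" "G n b = 0"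
    and n_deriv: "G nx n = 0" "G ny n = 0"
    and \<rho>: "\<rho> > 0"
    and second: "G nx a = - (2 * \<rho>)" "G nx b = 0" "G ny a = 0" "G ny b = - (2 * \<rho>)"
begin

text \<open>The determinant of the first fundamental form in the frame \<open>a\<close>,
  \<open>b\<close>.\<close>

definition "D = G a a * G b b - (G a b)\<^sup>2"

abbreviation "vol u v y \<equiv> G (C u v) y"

text \<open>Since \<open>n = k *\<^sub>R C a b\<close>, the equation \<open>G n n = 1\<close> reads
  \<open>k * vol a b n = 1\<close>. Here the positive orientation of the parameter enters.\<close>

lemma vol_pos: "vol a b n > 0"
proof -
  have "k * vol a b n = 1" using n(1) n_eq by (simp add: form_simps)
  then show ?thesis using k by (metis less_numeral_extra(1) zero_less_mult_pos)
qed

text \<open>As \<open>n\<close> is a unit vector orthogonal to \<open>a\<close> and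
  \<open>b\<close>, the Gram determinant of \<open>a\<close>, \<open>b\<close>, \<open>n\<close>
  reduces to that of \<open>a\<close>, \<open>b\<close>.\<close>

lemma vol_squared: "(vol a b n)\<^sup>2 = D"
proof -
  define M :: "real^3^3" where "M = (\<chi> i j. G (axis i 1) (axis j 1))"
  define d where "d = det (vector [a, b, n] :: real^3^3)"
  have "det M * d\<^sup>2 = det ((\<chi> i j. G (vector [a, b, n] $ i) (vector [a, b, n] $ j)) :: real^3^3)"
    by (simp add: det_gram_vectors[OF bil] M_def d_def)
  also have "\<dots> = D"
    using sym[of a n] sym[of b n] sym[of a b]
    by (simp add: det_3 n D_def power2_eq_square)
  finally have Md: "det M * d\<^sup>2 = D" .
  have v: "vol a b n = sqrt (det M) * d" by (simp add: C M_def d_def)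
  \<comment> \<open>Needed for \<open>det M \<ge> 0\<close>; only then does squaring
    \<open>sqrt (det M)\<close> give back \<open>det M\<close>.\<close>
  have "D \<ge> 0" using cauchy_schwarz[of a b] by (simp add: D_def)
  moreover have "d \<noteq> 0" using vol_pos v by auto
  ultimately have "det M \<ge> 0" using Md by (metis zero_le_mult_iff zero_le_power2 power2_less_0
    zero_less_power2 not_less mult_less_0_iff)
  then show ?thesis using Md v by (simp add: power_mult_distrib)
qed

lemma D_pos: "D > 0"
  using vol_pos vol_squared by (metis zero_less_power)

lemma vol_eq: "vol a b n = sqrt D"
  using vol_pos vol_squared by (metis less_imp_le real_sqrt_unique)

text \<open>Nonzero volume makes \<open>a\<close>, \<open>b\<close>, \<open>n\<close> a basis, so
  \<open>x - y\<close> is orthogonal to every vector and in particular to itself. All later vector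
  identities at a point are checked in this way.\<close>

lemma frame_eqI:
  assumes "G x a = G y a" "G x b = G y b" "G x n = G y n"
  shows "x = y"
proof -
  define P :: "real^3^3" where "P = vector [a, b, n]"
  have "det (transpose P) \<noteq> 0" using vol_pos by (auto simp: C P_def det_transpose)
  then obtain Q where "transpose P ** Q = mat 1"
    using invertible_det_nz invertible_def by blast
  \<comment> \<open>The columns of \<open>transpose P\<close> are \<open>a\<close>,
    \<open>b\<close>, \<open>n\<close>, so \<open>Q *v (x - y)\<close> holds the coefficients of
    \<open>x - y\<close> in this frame.\<close>
  then have "x - y = transpose P *v (Q *v (x - y))"
    by (simp add: matrix_vector_mul_assoc)
  also have "\<dots> = (\<Sum>i\<in>UNIV. (Q *v (x - y)) $ i *s P $ i)"
    by (simp add: matrix_mult_sum column_transpose row_def vec_nth_inverse)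
  finally obtain c :: "real^3" where c: "x - y = c $ 1 *\<^sub>R a + c $ 2 *\<^sub>R b + c $ 3 *\<^sub>R n"
    by (simp add: sum_3 P_def scalar_mult_eq_scaleR)
  have "G (x - y) (x - y) = G (x - y) (c $ 1 *\<^sub>R a + c $ 2 *\<^sub>R b + c $ 3 *\<^sub>R n)"
    using c by simp
  also have "\<dots> = 0" using assms by (simp add: form_simps)
  finally show ?thesis using pos[of "x - y"] by force
qed

text \<open>One of the Weingarten equations, for a second form with matrix \<open>2 * \<rho>\<close>
  times the identity.\<close>

lemma nx_eq: "nx = (- (2 * \<rho> / D)) *\<^sub>R (G b b *\<^sub>R a - G a b *\<^sub>R b)"
  using D_pos sym[of b n] sym[of a n] sym[of b a] sym[of n nx]
  by (intro frame_eqI) (simp_all add: form_simps second n n_deriv field_simps,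
    simp add: D_def power2_eq_square algebra_simps)

lemma ny_eq: "ny = (- (2 * \<rho> / D)) *\<^sub>R (G a a *\<^sub>R b - G a b *\<^sub>R a)"
  using D_pos sym[of b n] sym[of a n] sym[of b a] sym[of n ny]
  by (intro frame_eqI) (simp_all add: form_simps second n n_deriv field_simps,
    simp add: D_def power2_eq_square algebra_simps)

text \<open>The quotient of the determinants of the second and the first fundamental form;
  \<open>det_shape\<close> identifies it with the determinant of the shape operator.\<close>

definition "K = 4 * \<rho>\<^sup>2 / D"

lemma sqrt_K: "sqrt K = 2 * \<rho> / sqrt D"
  using \<rho> unfolding K_def by (simp add: real_sqrt_divide real_sqrt_mult)

lemma K_pos: "K > 0"
  using \<rho> D_pos by (simp add: K_def)

lemma vol_combination:
  "vol n (p *\<^sub>R a + q *\<^sub>R b) a = - q * sqrt D"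
  "vol n (p *\<^sub>R a + q *\<^sub>R b) b = p * sqrt D"
  "vol n (p *\<^sub>R a + q *\<^sub>R b) n = 0"
  unfolding vol_eq[symmetric] C by (simp_all add: det_3 algebra_simps)

text \<open>Expand \<open>nx\<close> and \<open>ny\<close> in the frame \<open>a\<close>,
  \<open>b\<close> and compare inner products with \<open>a\<close>, \<open>b\<close>,
  \<open>n\<close>: the volumes supply a factor \<open>sqrt D\<close>, and
  \<open>2 * \<rho> / D * sqrt D = sqrt K\<close>.\<close>

lemma cross_nx: "C n nx = - (sqrt K *\<^sub>R b)"
  and cross_ny: "C n ny = sqrt K *\<^sub>R a"
proof -
  have D: "sqrt D * sqrt D = D" "sqrt D > 0" using D_pos by simp_all
  have x: "nx = (- (2 * \<rho> / D) * G b b) *\<^sub>R a + (2 * \<rho> / D * G a b) *\<^sub>R b"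
    by (subst nx_eq) (simp add: scaleR_right_diff_distrib)
  have y: "ny = (2 * \<rho> / D * G a b) *\<^sub>R a + (- (2 * \<rho> / D) * G a a) *\<^sub>R b"
    by (subst ny_eq) (simp add: scaleR_right_diff_distrib)
  have r: "2 * \<rho> / D * sqrt D = sqrt K" using D by (simp add: sqrt_K field_simps)
  have r': "2 * \<rho> / D * t * sqrt D = sqrt K * t" for t using r by (metis mult.assoc mult.commute)
  show "C n nx = - (sqrt K *\<^sub>R b)"
    using sym[of b a] sym[of b n] r'[of "G a b"] r'[of "G b b"]
    by (intro frame_eqI; subst x)
      (simp_all only: vol_combination form_simps n, simp_all)
  show "C n ny = sqrt K *\<^sub>R a"
    using sym[of b a] sym[of a n] r'[of "G a b"] r'[of "G a a"]
    by (intro frame_eqI; subst y)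
      (simp_all only: vol_combination form_simps n, simp_all)
qed

text \<open>Division by \<open>sqrt K\<close> cancels \<rho>, leaving only coefficients of the first
  fundamental form. This is what later makes the normalised fields differentiable.\<close>

lemma normalized_nx: "(1 / sqrt K) *\<^sub>R nx = (- (1 / sqrt D)) *\<^sub>R (G b b *\<^sub>R a - G a b *\<^sub>R b)"
  and normalized_ny: "(1 / sqrt K) *\<^sub>R ny = (- (1 / sqrt D)) *\<^sub>R (G a a *\<^sub>R b - G a b *\<^sub>R a)"
proof -
  have "1 / sqrt K * (2 * \<rho> / D) = 1 / sqrt D"
    using D_pos \<rho> unfolding sqrt_K by (simp add: field_simps)
  then show "(1 / sqrt K) *\<^sub>R nx = (- (1 / sqrt D)) *\<^sub>R (G b b *\<^sub>R a - G a b *\<^sub>R b)"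
    "(1 / sqrt K) *\<^sub>R ny = (- (1 / sqrt D)) *\<^sub>R (G a a *\<^sub>R b - G a b *\<^sub>R a)"
    by (subst nx_eq ny_eq, metis (no_types, lifting) scaleR_scaleR mult_minus_right)+
qed

text \<open>Such an \<open>m\<close> is a multiple of \<open>n\<close>, and the volume vanishes on
  parallel arguments.\<close>

lemma cross_normal:
  assumes "G m a = 0" "G m b = 0"
  shows "C n m = 0"
proof -
  have "m = G m n *\<^sub>R n"
    using sym[of a n] sym[of b n] by (intro frame_eqI) (simp_all add: form_simps assms n)
  then obtain t where "m = t *\<^sub>R n" by blast
  then show ?thesis
    by (intro eqI) (simp add: C det_3 form_simps algebra_simps)
qed

text \<open>The columns of the matrix are the coordinates of \<open>- nx\<close> and
  \<open>- ny\<close> in the frame \<open>a\<close>, \<open>b\<close>, read off from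
  \<open>nx_eq\<close> and \<open>ny_eq\<close>. As \<open>matrix\<close> evaluates its argument
  only on axis vectors, \<open>W\<close> is prescribed only there.\<close>

lemma det_shape:
  fixes T :: "real^2 \<Rightarrow> real^3"
  assumes T: "linear T" "T (axis 1 1) = a" "T (axis 2 1) = b"
    and W: "W (axis 1 1) = nx" "W (axis 2 1) = ny"
  shows "det (matrix (\<lambda>u. THE w. T w = - W u)) = K"
proof -
  have T_eq: "T w = w $ 1 *\<^sub>R a + w $ 2 *\<^sub>R b" for w
  proof -
    have "w = w $ 1 *\<^sub>R axis 1 1 + w $ 2 *\<^sub>R axis 2 1"
      using basis_expansion[of w] by (simp add: sum_2 scalar_mult_eq_scaleR)
    then have "T w = T (w $ 1 *\<^sub>R axis 1 1 + w $ 2 *\<^sub>R axis 2 1)" by simp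
    then show ?thesis by (simp only: linear_add[OF T(1)] linear_cmul[OF T(1)] T(2,3))
  qed
  \<comment> \<open>Injectivity of \<open>T\<close> gives uniqueness for the \<open>THE\<close>: the
    volumes in \<open>vol_combination\<close> recover both coordinates.\<close>
  have inj: "w = w'" if "T w = T w'" for w w'
  proof -
    define p q where pq: "p = w $ 1 - w' $ 1" "q = w $ 2 - w' $ 2"
    have "p *\<^sub>R a + q *\<^sub>R b = 0" using that by (simp add: T_eq pq algebra_simps)
    then have "vol n 0 a = - q * sqrt D" "vol n 0 b = p * sqrt D"
      using vol_combination(1,2)[of p q] by simp_all
    moreover have "vol n 0 y = 0" for y by (simp add: C det_3)
    ultimately show ?thesis using D_pos by (simp add: pq vec_eq_iff forall_2)
  qed
  have The_eq: "(THE w. T w = - v) = w" if "T w = - v" for v w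
    using that inj by (metis (mono_tags, lifting) the_equality)
  have "(THE w. T w = - nx) = vector [2 * \<rho> / D * G b b, - (2 * \<rho> / D * G a b)]"
    by (rule The_eq, subst nx_eq) (simp add: T_eq scaleR_right_diff_distrib)
  moreover have "(THE w. T w = - ny) = vector [- (2 * \<rho> / D * G a b), 2 * \<rho> / D * G a a]"
    by (rule The_eq, subst ny_eq) (simp add: T_eq scaleR_right_diff_distrib)
  moreover have "r * G b b * (r * G a a) - (- (r * G a b)) * (- (r * G a b)) = r\<^sup>2 * D" for r
    by (simp add: D_def power2_eq_square algebra_simps)
  ultimately have "det (matrix (\<lambda>u. THE w. T w = - W u)) = (2 * \<rho> / D)\<^sup>2 * D"
    by (simp only: det_2 matrix_def W vec_lambda_beta vector_2)
  then show ?thesis using D_pos by (simp add: K_def power2_eq_square)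
qed

end

section \<open>Covariant differentiation in charts\<close>

lemma frechet_derivative_eqI:
  assumes "(f has_derivative f') (at x)" "open S" "x \<in> S" "\<And>y. y \<in> S \<Longrightarrow> f y = h y"
  shows "frechet_derivative h (at x) = f'"
  using has_derivative_transform_within_open[OF assms] by (rule frechet_derivative_at[symmetric])

lemma frechet_derivative_cong_open:
  assumes "open S" "x \<in> S" "\<And>y. y \<in> S \<Longrightarrow> f y = h y"
  shows "frechet_derivative f (at x) = frechet_derivative h (at x)"
proof -
  have "(f has_derivative f') (at x) \<longleftrightarrow> (h has_derivative f') (at x)" for f'
    using has_derivative_transform_within_open[of f f' x UNIV S h]
      has_derivative_transform_within_open[of h f' x UNIV S f] assms by auto
  then show ?thesis by (simp add: frechet_derivative_def)
qed

lemma smooth_on_has_derivative: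
  assumes "smooth_on S f" "x \<in> S"
  shows "(f has_derivative frechet_derivative f (at x)) (at x)"
proof -
  have "ck_on (Suc 0) S f" using assms(1) unfolding smooth_on_def by blast
  then show ?thesis using assms(2) frechet_derivative_works by auto
qed

lemma smooth_on_frechet_derivative:
  assumes "smooth_on S f"
  shows "smooth_on S (\<lambda>x. frechet_derivative f (at x) v)"
  unfolding smooth_on_def
proof
  fix k
  have "ck_on (Suc k) S f" using assms unfolding smooth_on_def by blast
  then show "ck_on k S (\<lambda>x. frechet_derivative f (at x) v)" by simp
qed

lemma
  assumes c: "is_chart X c"
  shows chart_inv_snd: "p \<in> fst c \<Longrightarrow> chart_inv c (snd c p) = p"
    and chart_inv_in: "x \<in> snd c ` fst c \<Longrightarrow> chart_inv c x \<in> fst c"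
    and open_chart_image: "U \<subseteq> fst c \<Longrightarrow> openin X U \<Longrightarrow> open (snd c ` U)"
proof -
  have sub: "fst c \<subseteq> topspace X" and op: "openin X (fst c)" "open (snd c ` fst c)"
    and hom: "homeomorphic_map (subtopology X (fst c)) (top_of_set (snd c ` fst c)) (snd c)"
    using c openin_subset unfolding is_chart_def by blast+
  have inj: "inj_on (snd c) (fst c)"
    using homeomorphic_imp_injective_map[OF hom] sub by (simp add: inf.absorb2)
  show "p \<in> fst c \<Longrightarrow> chart_inv c (snd c p) = p"
    using inj by (simp add: chart_inv_def)
  show "x \<in> snd c ` fst c \<Longrightarrow> chart_inv c x \<in> fst c"
    by (simp add: chart_inv_def inv_into_into)
  assume U: "U \<subseteq> fst c" "openin X U"
  then have "openin (subtopology X (fst c)) U"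
    by (simp add: openin_open_subtopology[OF op(1)])
  then have "openin (top_of_set (snd c ` fst c)) (snd c ` U)"
    using homeomorphic_map_openness_eq[OF hom] by blast
  then show "open (snd c ` U)" using op(2) by (simp add: openin_open_eq)
qed

lemma pos_form_metric:
  assumes "riemannian_metric B g" "d \<in> B" "q \<in> fst d"
  shows "pos_form (g d q)"
  using assms unfolding riemannian_metric_def by unfold_locales blast+

text \<open>The derivatives \<open>D\<close> of the metric components satisfy the hypotheses of
  \<open>ex1_christoffel\<close>, so the defining properties of the Christoffel symbols hold. The
  third claim is metric compatibility for constant components.\<close>

lemma
  assumes g: "riemannian_metric B g" "d \<in> B" and d: "is_chart Y d" and q: "q \<in> fst d"
  shows bilinear_christoffel: "bilinear (christoffel g d q)"
    and christoffel_sym: "christoffel g d q u v = christoffel g d q v u"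
    and has_derivative_metric: "((\<lambda>x. g d (chart_inv d x) u v) has_derivative
      (\<lambda>w. g d q (christoffel g d q w u) v + g d q u (christoffel g d q w v))) (at (snd d q))"
proof -
  let ?W = "snd d ` fst d"
  define h where "h u v x = g d (chart_inv d x) u v" for u v x
  define D where "D w u v = frechet_derivative (h u v) (at (snd d q)) w" for w u v
  have W: "open ?W" "snd d q \<in> ?W" using d q by (auto simp: is_chart_def)
  have form: "pos_form (g d (chart_inv d x))" if "x \<in> ?W" for x
    using pos_form_metric[OF g] chart_inv_in[OF d that] .
  have h: "(h u v has_derivative (\<lambda>w. D w u v)) (at (snd d q))" for u v
    using smooth_on_has_derivative[OF _ W(2), of "h u v"] g
    unfolding h_def[abs_def] D_def riemannian_metric_def by blast
  \<comment> \<open>By uniqueness of derivatives, pointwise identities between metric components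
    carry over to \<open>D\<close>; symmetry and bilinearity follow from this.\<close>
  have D_eq: "D w u v = f' w" if "(f has_derivative f') (at (snd d q))" "\<And>x. x \<in> ?W \<Longrightarrow> f x = h u v x"
    for f f' w u v
    using frechet_derivative_eqI[OF that(1) W that(2)] by (simp add: D_def)
  have D_sym: "D w u v = D w v u" for w u v
    by (rule D_eq[OF h]) (simp add: h_def pos_form.sym[OF form])
  have D_lin: "linear (\<lambda>w. D w u v)" for u v
    using h has_derivative_linear by blast
  have lin1: "linear (\<lambda>u. D w u v)" for w v
  proof (rule linearI)
    show "D w (u + u') v = D w u v + D w u' v" for u u'
      by (rule D_eq[OF has_derivative_add[OF h h]])
        (simp add: h_def bilinear_ladd[OF pos_form.bil[OF form]])
    show "D w (t *\<^sub>R u) v = t *\<^sub>R D w u v" for t u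
      by (rule D_eq[OF has_derivative_scaleR_right[OF h]])
        (simp add: h_def bilinear_lmul[OF pos_form.bil[OF form]])
  qed
  then have D_bil: "bilinear (D w)" for w
    unfolding bilinear_def using D_sym by (metis (no_types, lifting) ext)
  have C: "christoffel g d q = (THE C. bilinear C \<and> (\<forall>u v. C u v = C v u) \<and>
      (\<forall>w u v. D w u v = g d q (C w u) v + g d q u (C w v)))"
    unfolding christoffel_def D_def h_def ..
  have *: "bilinear (christoffel g d q) \<and>
      (\<forall>u v. christoffel g d q u v = christoffel g d q v u) \<and>
      (\<forall>w u v. D w u v = g d q (christoffel g d q w u) v + g d q u (christoffel g d q w v))"
    using theI'[OF pos_form.ex1_christoffel[OF pos_form_metric[OF g q] D_lin D_bil D_sym]]
    unfolding C .
  show "bilinear (christoffel g d q)" "christoffel g d q u v = christoffel g d q v u"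
    using * by blast+
  show "((\<lambda>x. g d (chart_inv d x) u v) has_derivative
      (\<lambda>w. g d q (christoffel g d q w u) v + g d q u (christoffel g d q w v))) (at (snd d q))"
    using h[of u v] * by (simp add: h_def[abs_def])
qed

lemma cross_prod_spec:
  assumes "riemannian_metric B g" "d \<in> B" "q \<in> fst d"
  shows "g d q (cross_prod g d q u v) y =
    sqrt (det (\<chi> i j. g d q (axis i 1) (axis j 1))) * det (vector [u, v, y] :: real^3^3)"
proof -
  have "linear (\<lambda>y. sqrt (det (gram g d q)) * det (vector [u, v, y] :: real^3^3))"
    by (rule linearI) (simp_all add: det_3 algebra_simps)
  from theI'[OF pos_form.riesz[OF pos_form_metric[OF assms] this]]
  show ?thesis unfolding cross_prod_def gram_def by blast
qed

section \<open>The covariant derivative along a map in a fixed pair of charts\<close>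

locale map_in_charts =
  fixes X :: "'s topology" and Y :: "'m topology" and B :: "('m, 'n::finite) chart set"
    and g :: "('m, 'n) metric" and \<phi> :: "'s \<Rightarrow> 'm"
    and c :: "('s, 'k::finite) chart" and d :: "('m, 'n) chart"
  assumes charts: "is_chart X c" "is_chart Y d" and d: "d \<in> B"
    and metric: "riemannian_metric B g" and continuous: "continuous_map X Y \<phi>"
    and smooth: "smooth_on (snd c ` overlap \<phi> c d) (local_rep \<phi> c d)"
begin

abbreviation "Ov \<equiv> overlap \<phi> c d"
abbreviation "T \<equiv> dmap \<phi> c d"
abbreviation "cov \<equiv> cov_deriv g \<phi> c d"
abbreviation "\<Gamma> \<equiv> christoffel g d"

definition field_differentiable_at :: "('s \<Rightarrow> 'v::real_normed_vector) \<Rightarrow> 's \<Rightarrow> bool" where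
  "field_differentiable_at V p \<longleftrightarrow> (V \<circ> chart_inv c) differentiable (at (snd c p))"

lemma overlapD: "p \<in> Ov \<Longrightarrow> p \<in> fst c" "p \<in> Ov \<Longrightarrow> \<phi> p \<in> fst d"
  by (auto simp: overlap_def)

lemma chart_inv_overlap:
  assumes "x \<in> snd c ` Ov"
  shows "chart_inv c x \<in> Ov" "snd c (chart_inv c x) = x"
  using assms chart_inv_snd[OF charts(1)] by (auto simp: overlap_def)

lemma open_overlap: "open (snd c ` Ov)"
proof -
  have "openin X (fst c)" "openin Y (fst d)" using charts by (auto simp: is_chart_def)
  then have "openin X (fst c \<inter> {p \<in> topspace X. \<phi> p \<in> fst d})"
    using continuous by (intro openin_Int openin_continuous_map_preimage)
  moreover have "fst c \<inter> {p \<in> topspace X. \<phi> p \<in> fst d} = Ov"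
    using openin_subset[OF \<open>openin X (fst c)\<close>] by (auto simp: overlap_def)
  ultimately show ?thesis using open_chart_image[OF charts(1)] overlapD(1) by (simp add: subset_iff)
qed

lemma inv_snd: "p \<in> Ov \<Longrightarrow> chart_inv c (snd c p) = p"
  using chart_inv_snd[OF charts(1)] overlapD(1) .

lemma form: "p \<in> Ov \<Longrightarrow> pos_form (g d (\<phi> p))"
  using pos_form_metric[OF metric d] overlapD(2) .

lemmas christoffel_facts =
  bilinear_christoffel[OF metric d charts(2) overlapD(2)]
  christoffel_sym[OF metric d charts(2) overlapD(2)]

lemma has_derivative_local_rep:
  assumes "p \<in> Ov"
  shows "(local_rep \<phi> c d has_derivative T p) (at (snd c p))"
  using smooth_on_has_derivative[OF smooth] assms by (simp add: dmap_def)

lemma linear_dmap: "p \<in> Ov \<Longrightarrow> linear (T p)"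
  by (rule has_derivative_linear[OF has_derivative_local_rep])

lemma field_has_derivative:
  assumes "field_differentiable_at V p"
  shows "((\<lambda>x. V (chart_inv c x)) has_derivative frechet_derivative (V \<circ> chart_inv c) (at (snd c p)))
    (at (snd c p))"
  using assms[unfolded field_differentiable_at_def frechet_derivative_works]
  by (simp only: comp_def)

lemma field_differentiable_atI:
  assumes "((\<lambda>x. V (chart_inv c x)) has_derivative V') (at (snd c p))"
  shows "field_differentiable_at V p"
  unfolding field_differentiable_at_def comp_def by (rule differentiableI[OF assms])

lemma field_differentiable_at_transform:
  assumes "field_differentiable_at V p" "p \<in> Ov" "\<And>q. q \<in> Ov \<Longrightarrow> V q = W q"
  shows "field_differentiable_at W p"
proof (rule field_differentiable_atI[OF has_derivative_transform_within_open])
  show "((\<lambda>x. V (chart_inv c x)) has_derivative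
      frechet_derivative (V \<circ> chart_inv c) (at (snd c p))) (at (snd c p))"
    by (rule field_has_derivative[OF assms(1)])
  show "snd c p \<in> snd c ` Ov" using assms(2) by (rule imageI)
  show "V (chart_inv c x) = W (chart_inv c x)" if "x \<in> snd c ` Ov" for x
    using assms(3) chart_inv_overlap(1)[OF that] .
qed (rule open_overlap)

text \<open>\<open>Ov\<close> has an open image in the chart and \<open>cov\<close> depends only on
  values near \<open>p\<close>. Identities known only on \<open>Ov\<close> can therefore be
  substituted under \<open>cov\<close>.\<close>

lemma cov_cong:
  assumes "p \<in> Ov" "\<And>q. q \<in> Ov \<Longrightarrow> V q = W q"
  shows "cov u V p = cov u W p"
proof -
  have "frechet_derivative (V \<circ> chart_inv c) (at (snd c p)) =
      frechet_derivative (W \<circ> chart_inv c) (at (snd c p))"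
    by (rule frechet_derivative_cong_open[OF open_overlap])
      (simp_all add: assms chart_inv_overlap(1))
  then show ?thesis using assms by (simp add: cov_deriv_def)
qed

lemma cov_zero: "p \<in> Ov \<Longrightarrow> cov u (\<lambda>q. 0) p = 0"
  by (simp add: cov_deriv_def comp_def bilinear_rzero[OF christoffel_facts(1)])

lemma cov_scaleR:
  assumes "p \<in> Ov" "field_differentiable_at V p"
  shows "cov u (\<lambda>q. t *\<^sub>R V q) p = t *\<^sub>R cov u V p"
proof -
  have "frechet_derivative ((\<lambda>q. t *\<^sub>R V q) \<circ> chart_inv c) (at (snd c p)) =
      (\<lambda>h. t *\<^sub>R frechet_derivative (V \<circ> chart_inv c) (at (snd c p)) h)"
    unfolding comp_def
    by (intro frechet_derivative_at[symmetric] has_derivative_scaleR_right)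
      (rule field_has_derivative[OF assms(2), unfolded comp_def])
  then show ?thesis
    by (simp add: cov_deriv_def scaleR_right_distrib bilinear_rmul[OF christoffel_facts(1)[OF assms(1)]])
qed

text \<open>On \<open>Ov\<close> the components of \<open>T q v\<close> are a directional derivative
  of \<open>local_rep \<phi> c d\<close>, so differentiating them gives its second
  derivatives.\<close>

lemma field_differentiable_dmap:
  assumes "p \<in> Ov"
  shows "field_differentiable_at (\<lambda>q. T q v) p"
    and "frechet_derivative ((\<lambda>q. T q v) \<circ> chart_inv c) (at (snd c p)) =
      frechet_derivative (\<lambda>x. frechet_derivative (local_rep \<phi> c d) (at x) v) (at (snd c p))"
proof -
  have p: "snd c p \<in> snd c ` Ov" using assms by simp
  have eq: "frechet_derivative (local_rep \<phi> c d) (at x) v = T (chart_inv c x) v"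
    if "x \<in> snd c ` Ov" for x
    using chart_inv_overlap[OF that] by (simp add: dmap_def)
  note D = smooth_on_has_derivative[OF smooth_on_frechet_derivative[OF smooth] p, of v]
  show "field_differentiable_at (\<lambda>q. T q v) p"
    by (rule field_differentiable_atI[OF has_derivative_transform_within_open[OF D open_overlap p eq]])
  show "frechet_derivative ((\<lambda>q. T q v) \<circ> chart_inv c) (at (snd c p)) =
      frechet_derivative (\<lambda>x. frechet_derivative (local_rep \<phi> c d) (at x) v) (at (snd c p))"
    by (rule frechet_derivative_eqI[OF D open_overlap p]) (simp add: eq)
qed

text \<open>Vanishing torsion along the map: second derivatives commute, and the Christoffel symbols
  are symmetric.\<close>

lemma cov_dmap_symmetric:
  assumes "p \<in> Ov"
  shows "cov u (\<lambda>q. T q v) p = cov v (\<lambda>q. T q u) p"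
proof -
  have p: "snd c p \<in> snd c ` Ov" using assms by simp
  have "frechet_derivative (\<lambda>x. frechet_derivative (local_rep \<phi> c d) (at x) v) (at (snd c p)) u =
      frechet_derivative (\<lambda>x. frechet_derivative (local_rep \<phi> c d) (at x) u) (at (snd c p)) v"
    by (rule second_derivative_symmetric[OF open_overlap p smooth_on_has_derivative[OF smooth]])
      (auto intro: smooth_on_has_derivative[OF smooth_on_frechet_derivative[OF smooth] p])
  then show ?thesis
    by (simp add: cov_deriv_def field_differentiable_dmap(2)[OF assms] christoffel_facts(2)[OF assms])
qed

text \<open>Metric compatibility along the map. The chain rule through \<open>local_rep\<close>
  differentiates the metric components, and the resulting Christoffel terms combine with the
  derivatives of \<open>U\<close> and \<open>V\<close> into \<open>cov\<close>.\<close>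

lemma has_derivative_metric_along:
  assumes p: "p \<in> Ov" and U: "field_differentiable_at U p" and V: "field_differentiable_at V p"
  shows "((\<lambda>x. g d (\<phi> (chart_inv c x)) (U (chart_inv c x)) (V (chart_inv c x))) has_derivative
    (\<lambda>w. g d (\<phi> p) (cov w U p) (V p) + g d (\<phi> p) (U p) (cov w V p))) (at (snd c p))"
proof -
  interpret pos_form "g d (\<phi> p)" using form[OF p] .
  note C = christoffel_facts(1)[OF p]
  have x: "snd c p \<in> snd c ` Ov" using p by simp
  have rep: "local_rep \<phi> c d (snd c p) = snd d (\<phi> p)"
    by (simp add: local_rep_def inv_snd[OF p])
  define H where "H x = g d (\<phi> (chart_inv c x))" for x
  define D where "D w u v = g d (\<phi> p) (\<Gamma> (\<phi> p) (T p w) u) v + g d (\<phi> p) u (\<Gamma> (\<phi> p) (T p w) v)"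
    for w u v
  have "((\<lambda>x. H x (U (chart_inv c x)) (V (chart_inv c x))) has_derivative
      (\<lambda>w. D w (U (chart_inv c (snd c p))) (V (chart_inv c (snd c p)))
        + H (snd c p) (frechet_derivative (U \<circ> chart_inv c) (at (snd c p)) w) (V (chart_inv c (snd c p)))
        + H (snd c p) (U (chart_inv c (snd c p))) (frechet_derivative (V \<circ> chart_inv c) (at (snd c p)) w)))
      (at (snd c p))"
  proof (rule has_derivative_bilinear_family[OF open_overlap x])
    show "bilinear (H y)" if "y \<in> snd c ` Ov" for y
      unfolding H_def using pos_form.bil[OF form] chart_inv_overlap(1)[OF that] .
    show "bilinear (D w)" for w
      unfolding bilinear_def D_def
      by (intro conjI allI linearI)
        (simp_all add: form_simps bilinear_radd[OF C] bilinear_rmul[OF C] algebra_simps)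
    have "((\<lambda>y. g d (chart_inv d y) u v) has_derivative
        (\<lambda>w. g d (\<phi> p) (\<Gamma> (\<phi> p) w u) v + g d (\<phi> p) u (\<Gamma> (\<phi> p) w v)))
        (at (local_rep \<phi> c d (snd c p)))" for u v
      unfolding rep by (rule has_derivative_metric[OF metric d charts(2) overlapD(2)[OF p]])
    from has_derivative_compose[OF has_derivative_local_rep[OF p] this]
    have "((\<lambda>y. g d (chart_inv d (local_rep \<phi> c d y)) u v) has_derivative (\<lambda>w. D w u v)) (at (snd c p))"
      for u v unfolding D_def .
    then show "((\<lambda>y. H y u v) has_derivative (\<lambda>w. D w u v)) (at (snd c p))" for u v
    proof (rule has_derivative_transform_within_open[OF _ open_overlap x])
      fix y assume "y \<in> snd c ` Ov"
      then show "g d (chart_inv d (local_rep \<phi> c d y)) u v = H y u v"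
        using chart_inv_snd[OF charts(2) overlapD(2)[OF chart_inv_overlap(1)]]
        by (simp add: H_def local_rep_def)
    qed
  qed (rule field_has_derivative U V)+
  then show ?thesis
    by (simp add: H_def D_def inv_snd[OF p] cov_deriv_def form_simps add_ac)
qed

text \<open>Turns a known inner product on \<open>Ov\<close> into an equation between covariant
  derivatives, by uniqueness of the derivative.\<close>

lemma metric_along_deriv_eq:
  assumes p: "p \<in> Ov" and U: "field_differentiable_at U p" and V: "field_differentiable_at V p"
    and f: "((\<lambda>x. f (chart_inv c x)) has_derivative f') (at (snd c p))"
    and eq: "\<And>q. q \<in> Ov \<Longrightarrow> f q = g d (\<phi> q) (U q) (V q)"
  shows "g d (\<phi> p) (cov w U p) (V p) + g d (\<phi> p) (U p) (cov w V p) = f' w"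
proof -
  have "((\<lambda>x. g d (\<phi> (chart_inv c x)) (U (chart_inv c x)) (V (chart_inv c x))) has_derivative f')
      (at (snd c p))"
    by (rule has_derivative_transform_within_open[OF f open_overlap])
      (simp_all add: p eq chart_inv_overlap(1))
  from has_derivative_unique[OF this has_derivative_metric_along[OF p U V]]
  show ?thesis by simp
qed

end

section \<open>Conformal parameters for the second fundamental form\<close>

locale conformal_surface = map_in_charts X Y B g \<phi> z d
  for X :: "'s topology" and Y :: "'m topology" and B :: "('m, 3) chart set" and g \<phi>
    and z :: "('s, 2) chart" and d +
  fixes N :: "('m, 3) chart \<Rightarrow> 's \<Rightarrow> real^3" and \<rho> :: "'s \<Rightarrow> real"
  assumes normal_differentiable: "p \<in> Ov \<Longrightarrow> field_differentiable_at (N d) p"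
    and normal_unit: "p \<in> Ov \<Longrightarrow> g d (\<phi> p) (N d p) (N d p) = 1"
    and normal_orthogonal: "p \<in> Ov \<Longrightarrow> g d (\<phi> p) (N d p) (T p u) = 0"
    and normal_direction: "p \<in> Ov \<Longrightarrow>
      \<exists>k>0. N d p = k *\<^sub>R cross_prod g d (\<phi> p) (T p dir_x) (T p dir_y)"
    and \<rho>_pos: "p \<in> Ov \<Longrightarrow> \<rho> p > 0"
    and second_form: "p \<in> Ov \<Longrightarrow> second_form g \<phi> N z d p u v = 2 * \<rho> p * (u \<bullet> v)"
begin

abbreviation "Tx p \<equiv> T p dir_x"
abbreviation "Ty p \<equiv> T p dir_y"
abbreviation "Nx p \<equiv> cov dir_x (N d) p"
abbreviation "Ny p \<equiv> cov dir_y (N d) p"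
abbreviation "K p \<equiv> extrinsic_curvature g \<phi> N z d p"
abbreviation "gram_det p \<equiv> conformal_point.D (g d (\<phi> p)) (Tx p) (Ty p)"

text \<open>Differentiate the constant function
  \<open>g d (\<phi> q) (N d q) (N d q) = 1\<close>.\<close>

lemma cov_normal_orthogonal:
  assumes "p \<in> Ov"
  shows "g d (\<phi> p) (cov u (N d) p) (N d p) = 0"
proof -
  have "g d (\<phi> p) (cov u (N d) p) (N d p) + g d (\<phi> p) (N d p) (cov u (N d) p) = 0"
    using assms normal_differentiable normal_unit
    by (intro metric_along_deriv_eq[where f = "\<lambda>_. 1" and f' = "\<lambda>_. 0"]) simp_all
  then show ?thesis using pos_form.sym[OF form[OF assms]] by simp
qed

text \<open>Makes the pointwise algebra available at \<open>p\<close>. The factor \<open>k\<close>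
  is existential because it is supplied separately at each point.\<close>

lemma ex_conformal_point:
  assumes "p \<in> Ov"
  shows "\<exists>k. conformal_point (g d (\<phi> p)) (cross_prod g d (\<phi> p)) (Tx p) (Ty p) (N d p) (Nx p) (Ny p)
    k (\<rho> p)"
proof -
  interpret pos_form "g d (\<phi> p)" using form[OF assms] .
  from normal_direction[OF assms] obtain k where k: "k > 0"
    "N d p = k *\<^sub>R cross_prod g d (\<phi> p) (Tx p) (Ty p)" by blast
  have II: "g d (\<phi> p) (cov u (N d) p) (T p v) = - (2 * \<rho> p * (u \<bullet> v))" for u v
    using second_form[OF assms, of u v] by (simp add: second_form_def form_simps)
  have "conformal_point (g d (\<phi> p)) (cross_prod g d (\<phi> p)) (Tx p) (Ty p) (N d p) (Nx p) (Ny p) k (\<rho> p)"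
    by unfold_locales
      (rule k cross_prod_spec[OF metric d overlapD(2)] normal_unit normal_orthogonal
        cov_normal_orthogonal \<rho>_pos assms | simp add: II dir_x_def dir_y_def inner_axis_axis)+
  then show ?thesis ..
qed

lemma curvature_eq:
  assumes "p \<in> Ov"
  shows "K p = conformal_point.K (g d (\<phi> p)) (Tx p) (Ty p) (\<rho> p)"
proof -
  obtain k where "conformal_point (g d (\<phi> p)) (cross_prod g d (\<phi> p)) (Tx p) (Ty p) (N d p) (Nx p) (Ny p)
    k (\<rho> p)" using ex_conformal_point[OF assms] by blast
  then interpret C: conformal_point "g d (\<phi> p)" "cross_prod g d (\<phi> p)" "Tx p" "Ty p" "N d p" "Nx p" "Ny p"
    k "\<rho> p" .
  show ?thesis
    using C.det_shape[OF linear_dmap[OF assms], of "\<lambda>u. cov u (N d) p"]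
    by (simp add: extrinsic_curvature_def shape_operator_def[abs_def] dir_x_def dir_y_def)
qed

lemma
  assumes "p \<in> Ov"
  shows K_pos: "K p > 0"
    and gram_det_pos: "gram_det p > 0"
    and cross_Nx: "cross_prod g d (\<phi> p) (N d p) (Nx p) = - (sqrt (K p) *\<^sub>R Ty p)"
    and cross_Ny: "cross_prod g d (\<phi> p) (N d p) (Ny p) = sqrt (K p) *\<^sub>R Tx p"
    and normalized_Nx: "(1 / sqrt (K p)) *\<^sub>R Nx p = (- (1 / sqrt (gram_det p))) *\<^sub>R
      (g d (\<phi> p) (Ty p) (Ty p) *\<^sub>R Tx p - g d (\<phi> p) (Tx p) (Ty p) *\<^sub>R Ty p)"
    and normalized_Ny: "(1 / sqrt (K p)) *\<^sub>R Ny p = (- (1 / sqrt (gram_det p))) *\<^sub>R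
      (g d (\<phi> p) (Tx p) (Tx p) *\<^sub>R Ty p - g d (\<phi> p) (Tx p) (Ty p) *\<^sub>R Tx p)"
    and cross_normal: "g d (\<phi> p) m (Tx p) = 0 \<Longrightarrow> g d (\<phi> p) m (Ty p) = 0 \<Longrightarrow>
      cross_prod g d (\<phi> p) (N d p) m = 0"
    and gram_det_eq: "gram_det p = g d (\<phi> p) (Tx p) (Tx p) * g d (\<phi> p) (Ty p) (Ty p)
      - (g d (\<phi> p) (Tx p) (Ty p))\<^sup>2"
proof -
  obtain k where "conformal_point (g d (\<phi> p)) (cross_prod g d (\<phi> p)) (Tx p) (Ty p) (N d p) (Nx p) (Ny p)
    k (\<rho> p)" using ex_conformal_point[OF assms] by blast
  then interpret C: conformal_point "g d (\<phi> p)" "cross_prod g d (\<phi> p)" "Tx p" "Ty p" "N d p" "Nx p" "Ny p"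
    k "\<rho> p" .
  show "K p > 0" "gram_det p > 0"
    "cross_prod g d (\<phi> p) (N d p) (Nx p) = - (sqrt (K p) *\<^sub>R Ty p)"
    "cross_prod g d (\<phi> p) (N d p) (Ny p) = sqrt (K p) *\<^sub>R Tx p"
    "(1 / sqrt (K p)) *\<^sub>R Nx p = (- (1 / sqrt (gram_det p))) *\<^sub>R
      (g d (\<phi> p) (Ty p) (Ty p) *\<^sub>R Tx p - g d (\<phi> p) (Tx p) (Ty p) *\<^sub>R Ty p)"
    "(1 / sqrt (K p)) *\<^sub>R Ny p = (- (1 / sqrt (gram_det p))) *\<^sub>R
      (g d (\<phi> p) (Tx p) (Tx p) *\<^sub>R Ty p - g d (\<phi> p) (Tx p) (Ty p) *\<^sub>R Tx p)"
    unfolding curvature_eq[OF assms]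
    by (rule C.K_pos C.D_pos C.cross_nx C.cross_ny C.normalized_nx C.normalized_ny)+
  show "gram_det p = g d (\<phi> p) (Tx p) (Tx p) * g d (\<phi> p) (Ty p) (Ty p)
      - (g d (\<phi> p) (Tx p) (Ty p))\<^sup>2"
    by (rule C.D_def)
  show "g d (\<phi> p) m (Tx p) = 0 \<Longrightarrow> g d (\<phi> p) m (Ty p) = 0 \<Longrightarrow>
      cross_prod g d (\<phi> p) (N d p) m = 0"
    by (rule C.cross_normal)
qed

section \<open>The normalised derivatives of the normal and their divergence\<close>

definition Px :: "'s \<Rightarrow> real^3" where "Px p = (1 / sqrt (K p)) *\<^sub>R Nx p"
definition Py :: "'s \<Rightarrow> real^3" where "Py p = (1 / sqrt (K p)) *\<^sub>R Ny p"

lemma has_derivative_inner_fields: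
  assumes p: "p \<in> Ov"
  shows "((\<lambda>x. g d (\<phi> (chart_inv z x)) (T (chart_inv z x) u) (T (chart_inv z x) v)) has_derivative
    (\<lambda>w. g d (\<phi> p) (cov w (\<lambda>q. T q u) p) (T p v) + g d (\<phi> p) (T p u) (cov w (\<lambda>q. T q v) p)))
    (at (snd z p))"
  by (rule has_derivative_metric_along[OF p field_differentiable_dmap(1)[OF p]
        field_differentiable_dmap(1)[OF p]])

text \<open>The factor 2 from differentiating \<open>g d (\<phi> p) (Tx p) (Tx p)\<close>, its
  analogue for \<open>Ty\<close> and the square of the mixed coefficient cancels the 2 in the
  derivative of the square root.\<close>

lemma has_derivative_sqrt_gram_det:
  assumes p: "p \<in> Ov"
  shows "((\<lambda>x. sqrt (gram_det (chart_inv z x))) has_derivative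
    (\<lambda>w. (g d (\<phi> p) (cov w Tx p) (Tx p) * g d (\<phi> p) (Ty p) (Ty p)
        + g d (\<phi> p) (Tx p) (Tx p) * g d (\<phi> p) (cov w Ty p) (Ty p)
        - g d (\<phi> p) (Tx p) (Ty p) * (g d (\<phi> p) (cov w Tx p) (Ty p) + g d (\<phi> p) (Tx p) (cov w Ty p)))
      / sqrt (gram_det p))) (at (snd z p))"
proof (rule has_derivative_transform_within_open[OF _ open_overlap])
  interpret pos_form "g d (\<phi> p)" using form[OF p] .
  let ?e = "\<lambda>u v x. g d (\<phi> (chart_inv z x)) (T (chart_inv z x) u) (T (chart_inv z x) v)"
  have e: "?e dir_x dir_x (snd z p) * ?e dir_y dir_y (snd z p) - (?e dir_x dir_y (snd z p))\<^sup>2 > 0"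
    using gram_det_pos[OF p] gram_det_eq[OF p] by (simp add: inv_snd[OF p])
  show "((\<lambda>x. sqrt (?e dir_x dir_x x * ?e dir_y dir_y x - (?e dir_x dir_y x)\<^sup>2)) has_derivative
    (\<lambda>w. (g d (\<phi> p) (cov w Tx p) (Tx p) * g d (\<phi> p) (Ty p) (Ty p)
        + g d (\<phi> p) (Tx p) (Tx p) * g d (\<phi> p) (cov w Ty p) (Ty p)
        - g d (\<phi> p) (Tx p) (Ty p) * (g d (\<phi> p) (cov w Tx p) (Ty p) + g d (\<phi> p) (Tx p) (cov w Ty p)))
      / sqrt (gram_det p))) (at (snd z p))"
    by (rule has_derivative_inner_fields[OF p] derivative_eq_intros e refl)+
      (simp add: fun_eq_iff inv_snd[OF p] gram_det_eq[OF p, symmetric] sym[of "Tx p" "cov _ Tx p"]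
        sym[of "Ty p" "cov _ Ty p"] field_simps,
        simp add: add_divide_distrib diff_divide_distrib)
next
  show "snd z p \<in> snd z ` Ov" using p by simp
  fix x assume "x \<in> snd z ` Ov"
  from chart_inv_overlap(1)[OF this]
  show "sqrt (g d (\<phi> (chart_inv z x)) (Tx (chart_inv z x)) (Tx (chart_inv z x))
      * g d (\<phi> (chart_inv z x)) (Ty (chart_inv z x)) (Ty (chart_inv z x))
      - (g d (\<phi> (chart_inv z x)) (Tx (chart_inv z x)) (Ty (chart_inv z x)))\<^sup>2)
    = sqrt (gram_det (chart_inv z x))"
    by (simp add: gram_det_eq)
qed

text \<open>\<open>normalized_Nx\<close> and \<open>normalized_Ny\<close> hold on all of
  \<open>Ov\<close> and express the fields through \<open>Tx\<close>, \<open>Ty\<close> and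
  coefficients of the first fundamental form.\<close>

lemma field_differentiable_P:
  assumes p: "p \<in> Ov"
  shows "field_differentiable_at Px p" "field_differentiable_at Py p"
proof -
  have "sqrt (gram_det (chart_inv z (snd z p))) \<noteq> 0"
    using gram_det_pos[OF p] by (simp add: inv_snd[OF p])
  note ds = differentiable_inverse[OF differentiableI[OF has_derivative_sqrt_gram_det[OF p]] this]
  note de = differentiableI[OF has_derivative_inner_fields[OF p]]
  note dT = differentiableI[OF field_has_derivative[OF field_differentiable_dmap(1)[OF p]]]
  note d = differentiable_minus differentiable_scaleR differentiable_diff ds de dT
  show "field_differentiable_at Px p"
  proof (rule field_differentiable_at_transform[OF _ p])
    show "field_differentiable_at (\<lambda>p. (- inverse (sqrt (gram_det p))) *\<^sub>R
      (g d (\<phi> p) (Ty p) (Ty p) *\<^sub>R Tx p - g d (\<phi> p) (Tx p) (Ty p) *\<^sub>R Ty p)) p"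
      unfolding field_differentiable_at_def comp_def by (intro d)
    show "(- inverse (sqrt (gram_det q))) *\<^sub>R
      (g d (\<phi> q) (Ty q) (Ty q) *\<^sub>R Tx q - g d (\<phi> q) (Tx q) (Ty q) *\<^sub>R Ty q) = Px q" if "q \<in> Ov" for q
      unfolding Px_def normalized_Nx[OF that] by (simp only: inverse_eq_divide)
  qed
  show "field_differentiable_at Py p"
  proof (rule field_differentiable_at_transform[OF _ p])
    show "field_differentiable_at (\<lambda>p. (- inverse (sqrt (gram_det p))) *\<^sub>R
      (g d (\<phi> p) (Tx p) (Tx p) *\<^sub>R Ty p - g d (\<phi> p) (Tx p) (Ty p) *\<^sub>R Tx p)) p"
      unfolding field_differentiable_at_def comp_def by (intro d)
    show "(- inverse (sqrt (gram_det q))) *\<^sub>R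
      (g d (\<phi> q) (Tx q) (Tx q) *\<^sub>R Ty q - g d (\<phi> q) (Tx q) (Ty q) *\<^sub>R Tx q) = Py q" if "q \<in> Ov" for q
      unfolding Py_def normalized_Ny[OF that] by (simp only: inverse_eq_divide)
  qed
qed

lemma metric_P:
  assumes p: "p \<in> Ov"
  shows "g d (\<phi> p) (Px p) (Tx p) = - sqrt (gram_det p)" "g d (\<phi> p) (Px p) (Ty p) = 0"
    "g d (\<phi> p) (Py p) (Tx p) = 0" "g d (\<phi> p) (Py p) (Ty p) = - sqrt (gram_det p)"
proof -
  interpret pos_form "g d (\<phi> p)" using form[OF p] .
  have "- (1 / sqrt (gram_det p)) * gram_det p = - sqrt (gram_det p)"
    using gram_det_pos[OF p] by (simp add: real_div_sqrt)
  then show "g d (\<phi> p) (Px p) (Tx p) = - sqrt (gram_det p)" "g d (\<phi> p) (Px p) (Ty p) = 0"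
    "g d (\<phi> p) (Py p) (Tx p) = 0" "g d (\<phi> p) (Py p) (Ty p) = - sqrt (gram_det p)"
    unfolding Px_def Py_def normalized_Nx[OF p] normalized_Ny[OF p]
    using sym[of "Ty p" "Tx p"]
    by (simp_all add: form_simps gram_det_eq[OF p] power2_eq_square mult_ac)
qed

text \<open>Write s for the square root of \<open>gram_det\<close>. Differentiating the products in
  \<open>metric_P\<close> and using \<nabla>_y \<open>Tx\<close> = \<nabla>_x \<open>Ty\<close>, the
  product with \<open>Tx\<close> is minus the sum of the x-derivative of s, the product of
  \<open>Px\<close> with \<nabla>_x \<open>Tx\<close> and that of \<open>Py\<close> with \<nabla>_x
  \<open>Ty\<close>. By \<open>P_eq\<close> the last two add up to minus the x-derivative of s. The
  case of \<open>Ty\<close> is the same with x and y interchanged.\<close>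

lemma divergence_normal:
  assumes p: "p \<in> Ov"
  shows "g d (\<phi> p) (cov dir_x Px p + cov dir_y Py p) (Tx p) = 0"
    and "g d (\<phi> p) (cov dir_x Px p + cov dir_y Py p) (Ty p) = 0"
proof -
  interpret pos_form "g d (\<phi> p)" using form[OF p] .
  note P = field_differentiable_P[OF p] and dT = field_differentiable_dmap(1)[OF p]
  note s = has_derivative_minus[OF has_derivative_sqrt_gram_det[OF p]]
  note xx = metric_along_deriv_eq[OF p P(1) dT s, OF metric_P(1)[symmetric], of dir_x]
  note xy = metric_along_deriv_eq[OF p P(1) dT has_derivative_const, OF metric_P(2)[symmetric], of dir_x]
  note yx = metric_along_deriv_eq[OF p P(2) dT has_derivative_const, OF metric_P(3)[symmetric], of dir_y]
  note yy = metric_along_deriv_eq[OF p P(2) dT s, OF metric_P(4)[symmetric], of dir_y]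
  have mixed: "cov dir_y Tx p = cov dir_x Ty p" by (rule cov_dmap_symmetric[OF p])
  have P_eq: "g d (\<phi> p) (Px p) v = - ((g d (\<phi> p) (Ty p) (Ty p) * g d (\<phi> p) (Tx p) v
      - g d (\<phi> p) (Tx p) (Ty p) * g d (\<phi> p) (Ty p) v) / sqrt (gram_det p))"
    "g d (\<phi> p) (Py p) v = - ((g d (\<phi> p) (Tx p) (Tx p) * g d (\<phi> p) (Ty p) v
      - g d (\<phi> p) (Tx p) (Ty p) * g d (\<phi> p) (Tx p) v) / sqrt (gram_det p))" for v
    unfolding Px_def Py_def normalized_Nx[OF p] normalized_Ny[OF p] by (simp_all add: form_simps)
  show "g d (\<phi> p) (cov dir_x Px p + cov dir_y Py p) (Tx p) = 0"
    using xx yx unfolding P_eq mixed sym[of "cov _ _ p"]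
    by (simp add: form_simps sym[of "cov _ _ p"] diff_divide_distrib add_divide_distrib algebra_simps)
  show "g d (\<phi> p) (cov dir_x Px p + cov dir_y Py p) (Ty p) = 0"
    using xy yy unfolding P_eq mixed sym[of "cov _ _ p"]
    by (simp add: form_simps sym[of "cov _ _ p"] diff_divide_distrib add_divide_distrib algebra_simps)
qed

end

section \<open>Complexification\<close>

lemma vcomplex_simps:
  "vRe (vcomplex a b) = a" "vIm (vcomplex a b) = b"
  "vcnj (vcomplex a b) = vcomplex a (- b)"
  "vcomplex a b + vcomplex a' b' = vcomplex (a + a') (b + b')"
  "vcomplex a b - vcomplex a' b' = vcomplex (a - a') (b - b')"
  "\<i> *s vcomplex a b = vcomplex (- b) a"
  "(1 / 2) *s vcomplex a b = vcomplex ((1 / 2) *\<^sub>R a) ((1 / 2) *\<^sub>R b)"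
  "(1 / of_real t) *s vcomplex a b = vcomplex ((1 / t) *\<^sub>R a) ((1 / t) *\<^sub>R b)"
  "(\<i> / of_real t) *s vcomplex a b = vcomplex (- ((1 / t) *\<^sub>R b)) ((1 / t) *\<^sub>R a)"
  by (simp_all add: vec_eq_iff vRe_def vIm_def vcnj_def vcomplex_def complex_eq_iff Re_divide_of_real
      Im_divide_of_real)

lemma vcomplex_zero: "vcomplex 0 0 = 0"
  by (simp add: vec_eq_iff vcomplex_def complex_eq_iff)

context map_in_charts
begin

lemma ccov_vcomplex:
  assumes "p \<in> Ov" "\<And>q. q \<in> Ov \<Longrightarrow> V q = vcomplex (R q) (I q)"
  shows "ccov_deriv g \<phi> c d u V p = vcomplex (cov u R p) (cov u I p)"
proof -
  have "cov u (\<lambda>q. vRe (V q)) p = cov u R p" "cov u (\<lambda>q. vIm (V q)) p = cov u I p"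
    by (rule cov_cong[OF assms(1)]; simp add: assms(2) vcomplex_simps)+
  then show ?thesis by (simp add: ccov_deriv_def)
qed

end

section \<open>Real and imaginary parts of the representation and of both integrability
  equations\<close>

context conformal_surface
begin

lemma nabla_vcomplex:
  assumes "p \<in> Ov" "\<And>q. q \<in> Ov \<Longrightarrow> V q = vcomplex (R q) (I q)"
  shows "nabla_z g \<phi> z d V p = vcomplex
      ((1 / 2) *\<^sub>R (cov dir_x R p + cov dir_y I p)) ((1 / 2) *\<^sub>R (cov dir_x I p - cov dir_y R p))"
    and "nabla_zbar g \<phi> z d V p = vcomplex
      ((1 / 2) *\<^sub>R (cov dir_x R p - cov dir_y I p)) ((1 / 2) *\<^sub>R (cov dir_x I p + cov dir_y R p))"
  by (simp_all add: nabla_z_def nabla_zbar_def ccov_vcomplex[OF assms] vcomplex_simps)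

lemma nabla_normal:
  assumes "p \<in> Ov"
  shows "nabla_z g \<phi> z d (\<lambda>q. vof_real (N d q)) p =
      vcomplex ((1 / 2) *\<^sub>R Nx p) (- ((1 / 2) *\<^sub>R Ny p))"
    and "nabla_zbar g \<phi> z d (\<lambda>q. vof_real (N d q)) p =
      vcomplex ((1 / 2) *\<^sub>R Nx p) ((1 / 2) *\<^sub>R Ny p)"
  by (simp_all add: vof_real_def nabla_vcomplex[OF assms refl] cov_zero[OF assms])

lemma ccross_vof_real:
  assumes "p \<in> Ov"
  shows "ccross g d (\<phi> p) (vof_real u) (vcomplex a b) =
    vcomplex (cross_prod g d (\<phi> p) u a) (cross_prod g d (\<phi> p) u b)"
proof -
  interpret pos_form "g d (\<phi> p)" using form[OF assms] .
  have "cross_prod g d (\<phi> p) 0 v = 0" for v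
    by (rule eqI) (simp add: cross_prod_spec[OF metric d overlapD(2)[OF assms]] det_3 form_simps)
  then show ?thesis by (simp add: ccross_def vof_real_def vcomplex_simps)
qed

lemma cross_prod_scaleR:
  assumes "p \<in> Ov"
  shows "cross_prod g d (\<phi> p) u (t *\<^sub>R v) = t *\<^sub>R cross_prod g d (\<phi> p) u v"
proof -
  interpret pos_form "g d (\<phi> p)" using form[OF assms] .
  show ?thesis
    by (rule eqI) (simp add: cross_prod_spec[OF metric d overlapD(2)[OF assms]] det_3 form_simps
        algebra_simps)
qed

lemma phi_z_eq: "phi_z \<phi> z d p = vcomplex ((1 / 2) *\<^sub>R Tx p) (- ((1 / 2) *\<^sub>R Ty p))"
  by (simp add: phi_z_def vof_real_def vcomplex_simps)

text \<open>By \<open>cross_Nx\<close> and \<open>cross_Ny\<close>, the cross product has real part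
  \<open>- sqrt (K p) / 2\<close> times \<open>Ty p\<close> and imaginary part
  \<open>- sqrt (K p) / 2\<close> times \<open>Tx p\<close>; multiplication by i and division by
  \<open>sqrt (K p)\<close> give \<open>phi_z\<close>.\<close>

lemma del_z_expr_eq:
  assumes "p \<in> Ov"
  shows "del_z_expr g \<phi> N z d p = phi_z \<phi> z d p"
proof -
  have "sqrt (K p) \<noteq> 0" using K_pos[OF assms] by simp
  then show ?thesis
    using cross_prod_scaleR[OF assms, of _ "- (1 / 2)"]
    by (simp add: del_z_expr_def nabla_normal[OF assms] ccross_vof_real[OF assms] phi_z_eq
        cross_prod_scaleR[OF assms] cross_Nx[OF assms] cross_Ny[OF assms] vcomplex_simps)
qed

text \<open>With the fields replaced by \<open>phi_z\<close> and its conjugate, the real parts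
  agree, and the imaginary parts are opposite multiples of \<nabla>_x \<open>Ty\<close> - \<nabla>_y
  \<open>Tx\<close>, which vanishes.\<close>

lemma torsion_free:
  assumes "p \<in> Ov"
  shows "nabla_z g \<phi> z d (\<lambda>q. vcnj (del_z_expr g \<phi> N z d q)) p
    = nabla_zbar g \<phi> z d (\<lambda>q. del_z_expr g \<phi> N z d q) p"
proof -
  note half = cov_scaleR[OF assms field_differentiable_dmap(1)[OF assms]]
  have 1: "vcnj (del_z_expr g \<phi> N z d q) = vcomplex ((1 / 2) *\<^sub>R Tx q) ((1 / 2) *\<^sub>R Ty q)" if "q \<in> Ov" for q
    by (simp add: del_z_expr_eq[OF that] phi_z_eq vcomplex_simps)
  \<comment> \<open>The sign is kept in the scalar so that \<open>cov_scaleR\<close> applies to the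
    imaginary part.\<close>
  have 2: "del_z_expr g \<phi> N z d q = vcomplex ((1 / 2) *\<^sub>R Tx q) ((- (1 / 2)) *\<^sub>R Ty q)" if "q \<in> Ov" for q
    by (simp add: del_z_expr_eq[OF that] phi_z_eq)
  have "nabla_z g \<phi> z d (\<lambda>q. vcnj (del_z_expr g \<phi> N z d q)) p = vcomplex
      ((1 / 2) *\<^sub>R (cov dir_x (\<lambda>q. (1 / 2) *\<^sub>R Tx q) p + cov dir_y (\<lambda>q. (1 / 2) *\<^sub>R Ty q) p))
      ((1 / 2) *\<^sub>R (cov dir_x (\<lambda>q. (1 / 2) *\<^sub>R Ty q) p - cov dir_y (\<lambda>q. (1 / 2) *\<^sub>R Tx q) p))"
    by (rule nabla_vcomplex(1)[OF assms 1])
  moreover have "nabla_zbar g \<phi> z d (\<lambda>q. del_z_expr g \<phi> N z d q) p = vcomplex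
      ((1 / 2) *\<^sub>R (cov dir_x (\<lambda>q. (1 / 2) *\<^sub>R Tx q) p - cov dir_y (\<lambda>q. (- (1 / 2)) *\<^sub>R Ty q) p))
      ((1 / 2) *\<^sub>R (cov dir_x (\<lambda>q. (- (1 / 2)) *\<^sub>R Ty q) p + cov dir_y (\<lambda>q. (1 / 2) *\<^sub>R Tx q) p))"
    by (rule nabla_vcomplex(2)[OF assms 2])
  ultimately show ?thesis
    unfolding half by (simp add: cov_dmap_symmetric[OF assms, of dir_x dir_y])
qed

text \<open>In the sum the imaginary parts cancel and the real part is half of \<open>?m\<close>,
  which is normal by \<open>divergence_normal\<close>.\<close>

lemma normal_divergence:
  assumes "p \<in> Ov"
  shows "ccross g d (\<phi> p) (vof_real (N d p))
    (nabla_z g \<phi> z d (\<lambda>q. (1 / of_real (sqrt (K q))) *s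
        nabla_zbar g \<phi> z d (\<lambda>r. vof_real (N d r)) q) p
      + nabla_zbar g \<phi> z d (\<lambda>q. (1 / of_real (sqrt (K q))) *s
        nabla_z g \<phi> z d (\<lambda>r. vof_real (N d r)) q) p) = 0"
proof -
  note half = cov_scaleR[OF assms field_differentiable_P(1)[OF assms]]
    cov_scaleR[OF assms field_differentiable_P(2)[OF assms]]
  have 1: "(1 / of_real (sqrt (K q))) *s nabla_zbar g \<phi> z d (\<lambda>r. vof_real (N d r)) q =
      vcomplex ((1 / 2) *\<^sub>R Px q) ((1 / 2) *\<^sub>R Py q)" if "q \<in> Ov" for q
    by (simp add: nabla_normal[OF that] vcomplex_simps Px_def Py_def mult.commute)
  have 2: "(1 / of_real (sqrt (K q))) *s nabla_z g \<phi> z d (\<lambda>r. vof_real (N d r)) q =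
      vcomplex ((1 / 2) *\<^sub>R Px q) ((- (1 / 2)) *\<^sub>R Py q)" if "q \<in> Ov" for q
    by (simp add: nabla_normal[OF that] vcomplex_simps Px_def Py_def mult.commute)
  let ?m = "cov dir_x Px p + cov dir_y Py p"
  have cross: "cross_prod g d (\<phi> p) (N d p) ?m = 0"
    by (rule cross_normal[OF assms divergence_normal[OF assms]])
  have "nabla_z g \<phi> z d (\<lambda>q. (1 / of_real (sqrt (K q))) *s
        nabla_zbar g \<phi> z d (\<lambda>r. vof_real (N d r)) q) p = vcomplex
      ((1 / 2) *\<^sub>R (cov dir_x (\<lambda>q. (1 / 2) *\<^sub>R Px q) p + cov dir_y (\<lambda>q. (1 / 2) *\<^sub>R Py q) p))
      ((1 / 2) *\<^sub>R (cov dir_x (\<lambda>q. (1 / 2) *\<^sub>R Py q) p - cov dir_y (\<lambda>q. (1 / 2) *\<^sub>R Px q) p))"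
    by (rule nabla_vcomplex(1)[OF assms 1])
  moreover have "nabla_zbar g \<phi> z d (\<lambda>q. (1 / of_real (sqrt (K q))) *s
        nabla_z g \<phi> z d (\<lambda>r. vof_real (N d r)) q) p = vcomplex
      ((1 / 2) *\<^sub>R (cov dir_x (\<lambda>q. (1 / 2) *\<^sub>R Px q) p - cov dir_y (\<lambda>q. (- (1 / 2)) *\<^sub>R Py q) p))
      ((1 / 2) *\<^sub>R (cov dir_x (\<lambda>q. (- (1 / 2)) *\<^sub>R Py q) p + cov dir_y (\<lambda>q. (1 / 2) *\<^sub>R Px q) p))"
    by (rule nabla_vcomplex(2)[OF assms 2])
  \<comment> \<open>The zero imaginary part is written as a multiple of \<open>?m\<close>, so that
    \<open>cross_prod_scaleR\<close> and \<open>cross\<close> treat both parts alike.\<close>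
  ultimately have "nabla_z g \<phi> z d (\<lambda>q. (1 / of_real (sqrt (K q))) *s
        nabla_zbar g \<phi> z d (\<lambda>r. vof_real (N d r)) q) p
      + nabla_zbar g \<phi> z d (\<lambda>q. (1 / of_real (sqrt (K q))) *s
        nabla_z g \<phi> z d (\<lambda>r. vof_real (N d r)) q) p = vcomplex ((1 / 2) *\<^sub>R ?m) (0 *\<^sub>R ?m)"
    unfolding half
    by (simp only: vcomplex_simps, intro arg_cong2[of _ _ _ _ vcomplex]) (simp_all add: vec_eq_iff field_simps)
  then show ?thesis
    unfolding ccross_vof_real[OF assms] cross_prod_scaleR[OF assms] cross
    by (simp add: ccross_vof_real[OF assms] cross_prod_scaleR[OF assms] cross vcomplex_zero
        del: scaleR_zero_left)
qed

end

section \<open>Passage from the global hypotheses to one parameter and one positive ambient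
  chart\<close>

theorem proposition2p1:
  fixes X :: "'s topology" and A :: "('s, 2) chart set" and h :: "('s, 2) metric"
    and Y :: "'m topology" and B Or :: "('m, 3) chart set" and g :: "('m, 3) metric"
    and \<phi> :: "'s \<Rightarrow> 'm" and N :: "('m, 3) chart \<Rightarrow> 's \<Rightarrow> real^3"
    and z :: "('s, 2) chart"
  assumes surface: "riemannian_manifold X A h"
    and ambient: "riemannian_manifold Y B g" "orientation Y B Or"
    and isometric: "isometric_immersion X A h Y B g \<phi>"
    and normal: "unit_normal A B g \<phi> N"
    and curvature_pos:
      "\<And>c d p. c \<in> A \<Longrightarrow> d \<in> B \<Longrightarrow> p \<in> overlap \<phi> c d \<Longrightarrow> extrinsic_curvature g \<phi> N c d p > 0"
    and second_form_pos:
      "\<And>c d p u. c \<in> A \<Longrightarrow> d \<in> B \<Longrightarrow> p \<in> overlap \<phi> c d \<Longrightarrow> u \<noteq> 0 \<Longrightarrow> second_form g \<phi> N c d p u u > 0"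
    and conformal: "conformal_parameter A Or g \<phi> N z"
  shows "\<forall>d\<in>Or. \<forall>p\<in>overlap \<phi> z d.
     phi_z \<phi> z d p =
       (\<i> / of_real (sqrt (extrinsic_curvature g \<phi> N z d p))) *s
         ccross g d (\<phi> p) (vof_real (N d p)) (nabla_z g \<phi> z d (\<lambda>q. vof_real (N d q)) p) \<and>
     (nabla_z g \<phi> z d (\<lambda>q. vcnj (del_z_expr g \<phi> N z d q)) p
        - nabla_zbar g \<phi> z d (\<lambda>q. del_z_expr g \<phi> N z d q) p = 0
      \<longleftrightarrow>
      ccross g d (\<phi> p) (vof_real (N d p))
        (nabla_z g \<phi> z d
           (\<lambda>q. (1 / of_real (sqrt (extrinsic_curvature g \<phi> N z d q))) *s
                  nabla_zbar g \<phi> z d (\<lambda>r. vof_real (N d r)) q) p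
         + nabla_zbar g \<phi> z d
           (\<lambda>q. (1 / of_real (sqrt (extrinsic_curvature g \<phi> N z d q))) *s
                  nabla_z g \<phi> z d (\<lambda>r. vof_real (N d r)) q) p) = 0)"
proof (intro ballI conjI)
  fix d p assume dOr: "d \<in> Or" and p: "p \<in> overlap \<phi> z d"
  have z: "z \<in> A" and direction: "\<And>q. q \<in> overlap \<phi> z d \<Longrightarrow> \<exists>k>0.
      N d q = k *\<^sub>R cross_prod g d (\<phi> q) (dmap \<phi> z d q dir_x) (dmap \<phi> z d q dir_y)"
    using conformal dOr unfolding conformal_parameter_def by blast+
  \<comment> \<open>The function \<rho> depends only on the point; its equation is available because
    \<open>d\<close> is a positive chart.\<close>
  obtain \<rho> where \<rho>: "\<And>q. q \<in> overlap \<phi> z d \<Longrightarrow> \<rho> q > 0"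
    "\<And>q u v. q \<in> overlap \<phi> z d \<Longrightarrow> second_form g \<phi> N z d q u v = 2 * \<rho> q * (u \<bullet> v)"
    using conformal dOr unfolding conformal_parameter_def overlap_def by blast
  have d: "d \<in> B" using ambient(2) dOr unfolding orientation_def by blast
  have map: "is_chart X z" "is_chart Y d" "riemannian_metric B g" "continuous_map X Y \<phi>"
    "smooth_on (snd z ` overlap \<phi> z d) (local_rep \<phi> z d)"
  proof -
    have "smooth_atlas X A" "smooth_atlas Y B"
      using surface ambient(1) unfolding riemannian_manifold_def smooth_manifold_def by simp_all
    then show "is_chart X z" "is_chart Y d"
      using z d unfolding smooth_atlas_def by simp_all
    show "riemannian_metric B g" using ambient(1) unfolding riemannian_manifold_def by simp
    have "smooth_map X A Y B \<phi>"
      using isometric unfolding isometric_immersion_def immersion_def by simp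
    then show "continuous_map X Y \<phi>" "smooth_on (snd z ` overlap \<phi> z d) (local_rep \<phi> z d)"
      using z d unfolding smooth_map_def by simp_all
  qed
  interpret map_in_charts X Y B g \<phi> z d
    by unfold_locales (rule map d)+
  have N: "smooth_on (snd z ` overlap \<phi> z d) (N d \<circ> chart_inv z)"
    "\<And>q. q \<in> overlap \<phi> z d \<Longrightarrow> g d (\<phi> q) (N d q) (N d q) = 1"
    "\<And>q u. q \<in> overlap \<phi> z d \<Longrightarrow> g d (\<phi> q) (N d q) (dmap \<phi> z d q u) = 0"
    using normal z d unfolding unit_normal_def smooth_field_along_def by simp_all
  interpret conformal_surface X Y B g \<phi> z d N \<rho>
  proof
    show "field_differentiable_at (N d) q" if "q \<in> overlap \<phi> z d" for q
      unfolding field_differentiable_at_def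
      by (rule differentiableI[OF smooth_on_has_derivative[OF N(1) imageI[OF that]]])
  qed (rule N direction \<rho>; assumption)+
  show "phi_z \<phi> z d p =
       (\<i> / of_real (sqrt (extrinsic_curvature g \<phi> N z d p))) *s
         ccross g d (\<phi> p) (vof_real (N d p)) (nabla_z g \<phi> z d (\<lambda>q. vof_real (N d q)) p)"
    unfolding del_z_expr_eq[OF p, symmetric] del_z_expr_def ..
  show "nabla_z g \<phi> z d (\<lambda>q. vcnj (del_z_expr g \<phi> N z d q)) p
        - nabla_zbar g \<phi> z d (\<lambda>q. del_z_expr g \<phi> N z d q) p = 0
      \<longleftrightarrow>
      ccross g d (\<phi> p) (vof_real (N d p))
        (nabla_z g \<phi> z d
           (\<lambda>q. (1 / of_real (sqrt (extrinsic_curvature g \<phi> N z d q))) *s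
                  nabla_zbar g \<phi> z d (\<lambda>r. vof_real (N d r)) q) p
         + nabla_zbar g \<phi> z d
           (\<lambda>q. (1 / of_real (sqrt (extrinsic_curvature g \<phi> N z d q))) *s
                  nabla_z g \<phi> z d (\<lambda>r. vof_real (N d r)) q) p) = 0"
    \<comment> \<open>Both sides are true: the left one becomes the difference of a field with
      itself, the right one \<open>0 = 0\<close>.\<close>
    unfolding torsion_free[OF p] normal_divergence[OF p] by simp
qed

end
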